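(* Let $m$ be even with $0<m\le p$. The map $\Phi=\Phi_{m,p}:(\mathrm{Gr}_m(\mathbf{R}^p),d_{Gr})\to(\mathrm{Inv}_m(p),d_{SO})$ is an isometry up to a constant factor of 2: $$d_{SO}(\Phi(W),\Phi(V))=2\,d_{Gr}(W,V)$$ for all $W,V\in\mathrm{Gr}_m(\mathbf{R}^p)$.
   Context: Let $p\ge2$. $SO(p)$ carries the bi-invariant Riemannian metric given at the identity by $g_{SO}(A_1,A_2)=-\frac12\mathrm{tr}(A_1A_2)$, with geodesic distance $d_{SO}$; thus $d_{SO}(U,V)=\min\{\frac{1}{\sqrt2}\|A\|_F : A\in\mathfrak{so}(p),\ \exp(A)=U^{-1}V\}$. $\mathrm{Inv}_m(p)$ is the set of involutions $R\in SO(p)$ ($R^2=I\ne R$) whose $(-1)$-eigenspace has dimension $m$. $\mathrm{Gr}_m(\mathbf{R}^p)$ is the Grassmannian of $m$-dimensional subspaces of $\mathbf{R}^p$. $\Phi_{m,p}(W)=I-2P_W$, where $P_W$ is the matrix of orthogonal projection onto $W$; it is the involution whose $(-1)$-eigenspace is $W$, and $\Phi_{m,p}$ is a bijection onto $\mathrm{Inv}_m(p)$. The distance on the Grassmannian is $d_{Gr}(W,Z)=\left(\sum_{i=1}^m\phi_i(W,Z)^2\right)^{1/2}$, where $\phi_1(W,Z),\dots,\phi_m(W,Z)\in[0,\pi/2]$ are the principal angles between $W$ and $Z$ (the arccosines of the singular values of $\tilde W^T\tilde Z$, where the columns of $\tilde W,\tilde Z$ are orthonormal bases of $W,Z$). 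*)

theory Defs
  imports "HOL-Analysis.Analysis"
begin

section \<open>The rotation group with its bi-invariant metric\<close>

definition SO :: "(real^'p^'p) set" where
  "SO = {U. rotation_matrix U}"

definition g_SO :: "real^'p^'p \<Rightarrow> real^'p^'p \<Rightarrow> real" where
  "g_SO A B = - (1/2) * trace (A ** B)"

text \<open>The bi-invariant metric at \<open>U\<close>: tangent vectors \<open>X, Y\<close> at \<open>U\<close> are pulled back
  to the Lie algebra of skew-symmetric matrices by left translation.\<close>

definition g_SO_at :: "real^'p^'p \<Rightarrow> real^'p^'p \<Rightarrow> real^'p^'p \<Rightarrow> real" where
  "g_SO_at U X Y = g_SO (matrix_inv U ** X) (matrix_inv U ** Y)"

definition SO_path :: "(real \<Rightarrow> real^'p^'p) \<Rightarrow> real^'p^'p \<Rightarrow> real^'p^'p \<Rightarrow> bool" where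
  "SO_path \<gamma> U V \<longleftrightarrow>
     \<gamma> C1_differentiable_on {0..1} \<and> \<gamma> ` {0..1} \<subseteq> SO \<and> \<gamma> 0 = U \<and> \<gamma> 1 = V"

definition SO_length :: "(real \<Rightarrow> real^'p^'p) \<Rightarrow> real" where
  "SO_length \<gamma> =
     integral {0..1} (\<lambda>t. sqrt (g_SO_at (\<gamma> t) (vector_derivative \<gamma> (at t))
                                             (vector_derivative \<gamma> (at t))))"

text \<open>The geodesic (Riemannian) distance. Since \<open>SO\<close> is path connected, the infimum
  is over a nonempty set for \<open>U, V \<in> SO\<close>. Requiring the paths to be \<open>C\<^sup>1\<close> on the closed
  interval makes the speed continuous, so the length integral always exists.\<close>

definition d_SO :: "real^'p^'p \<Rightarrow> real^'p^'p \<Rightarrow> real" where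
  "d_SO U V = Inf {SO_length \<gamma> | \<gamma>. SO_path \<gamma> U V}"

definition Inv_SO :: "nat \<Rightarrow> (real^'p^'p) set" where
  "Inv_SO m = {R \<in> SO. R ** R = mat 1 \<and> R \<noteq> mat 1 \<and> dim {x. R *v x = - x} = m}"

section \<open>The Grassmannian and its principal-angle distance\<close>

definition Gr :: "nat \<Rightarrow> (real^'p) set set" where
  "Gr m = {W. subspace W \<and> dim W = m}"

definition orthonormal_basis_of :: "real^'m^'p \<Rightarrow> (real^'p) set \<Rightarrow> bool" where
  "orthonormal_basis_of A W \<longleftrightarrow>
     (\<forall>i j. column i A \<bullet> column j A = (if i = j then 1 else 0)) \<and> span (columns A) = W"

text \<open>An enumeration \<open>s\<close>, with multiplicities, of the singular values of \<open>M\<close>, that is,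
  of the nonnegative square roots of the eigenvalues of \<open>M\<^sup>T M\<close>. As \<open>M\<^sup>T M\<close> is symmetric,
  the multiplicity of an eigenvalue is the dimension of its eigenspace.\<close>

definition is_singular_values :: "real^'m^'n \<Rightarrow> ('m \<Rightarrow> real) \<Rightarrow> bool" where
  "is_singular_values M s \<longleftrightarrow>
     (\<forall>i. 0 \<le> s i) \<and>
     (\<forall>\<sigma>\<ge>0. card {i. s i = \<sigma>} = dim {x. (transpose M ** M) *v x = \<sigma>\<^sup>2 *\<^sub>R x})"

definition singular_value :: "real^'m^'n \<Rightarrow> 'm \<Rightarrow> real" where
  "singular_value M = (SOME s. is_singular_values M s)"

text \<open>Changing the orthonormal bases replaces \<open>transpose A ** B\<close> by a product with orthogonal
  matrices on both sides, so the angles do not depend on the chosen bases, up to their order.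
  The index type \<open>'m\<close> plays the role of \<open>{1,\<dots>,m}\<close>; the angles are meaningful if
  \<open>W\<close> and \<open>Z\<close> both have dimension \<open>CARD('m)\<close>.\<close>

definition principal_angle :: "(real^'p) set \<Rightarrow> (real^'p) set \<Rightarrow> 'm::finite \<Rightarrow> real" where
  "principal_angle W Z i =
     (let A = (SOME A :: real^'m^'p. orthonormal_basis_of A W);
          B = (SOME B :: real^'m^'p. orthonormal_basis_of B Z)
      in arccos (singular_value (transpose A ** B) i))"

definition d_Gr :: "'m::finite itself \<Rightarrow> (real^'p) set \<Rightarrow> (real^'p) set \<Rightarrow> real" where
  "d_Gr _ W Z = sqrt (\<Sum>i\<in>(UNIV :: 'm set). (principal_angle W Z i)\<^sup>2)"

section \<open>The involution with a given (-1)-eigenspace\<close>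

definition orth_proj :: "(real^'p) set \<Rightarrow> real^'p \<Rightarrow> real^'p" where
  "orth_proj W x = (THE y. y \<in> W \<and> (\<forall>w\<in>W. orthogonal (x - y) w))"

definition Phi :: "(real^'p) set \<Rightarrow> real^'p^'p" where
  "Phi W = mat 1 - 2 *\<^sub>R matrix (orth_proj W)"

end

theory Submission
  imports Defs
begin

text \<open>
  The map \<open>Phi\<close> is bijective because an orthogonal involution is determined by its \<open>(-1)\<close>-eigenspace; its
  values have determinant 1 since, in even dimension, the half turn on \<open>W\<close> is the square of a quarter
  turn (\<open>frame_involution_SO\<close>).

  For the distance, let \<open>\<phi> i\<close> be the principal angles of \<open>W\<close> and \<open>V\<close>. The singular value decomposition
  supplies orthonormal frames \<open>A\<close> of \<open>W\<close> and \<open>B\<close> of \<open>V\<close> with \<open>transpose A ** B\<close> diagonal with entries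
  \<open>cos (\<phi> i)\<close> (\<open>ex_principal_frames\<close>). Rotating each vector of \<open>A\<close> to its partner in \<open>B\<close> gives a path of
  involutions of length \<open>2 sqrt (\<Sum>i. (\<phi> i)\<^sup>2)\<close> (\<open>ex_SO_path_principal_angles\<close>), so it remains to show
  that no path in \<open>SO\<close> from \<open>U\<close> to \<open>V\<close> is shorter than that.

  The orthogonal matrix \<open>Q = U\<^sup>T V\<close> rotates by the angles \<open>2 (\<phi> i)\<close>, and the quantity to bound is the root
  of the sum of its squared eigenangles \<open>\<theta>\<close>. Up to a constant this is the root of the trace of
  \<open>g (Y Q)\<close>, where \<open>Y Q = 1 - (Q + Q\<^sup>T) / 2\<close> and \<open>g y = (arccos (1 - y))\<^sup>2\<close>, so
  that \<open>g (1 - cos \<theta>) = \<theta>\<^sup>2\<close>. If \<open>g\<close> were smooth, the derivative of this trace along a path could be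
  computed directly: by the Cauchy-Schwarz inequality it is at most \<open>2 sqrt (trace (g (Y Q)))\<close>
  times the Frobenius speed, because \<open>y (2 - y) (g' y)\<^sup>2 = 4 g y\<close>. But \<open>g'\<close> is unbounded at \<open>y = 2\<close>, where an
  eigenangle is \<open>\<pi>\<close>, and this occurs exactly when a principal angle is \<open>\<pi> / 2\<close>.

  Therefore \<open>g\<close> is replaced by the partial sums \<open>T\<close> of its power series in \<open>y\<close>. All coefficients are
  nonnegative, and the differential equation \<open>y (2 - y) g'' + (1 - y) g' = 2\<close> holds for \<open>T\<close> up to a single term
  with a favourable sign (\<open>arcsq_ode\<close>). So \<open>y (2 - y) (T' y)\<^sup>2 \<le> 4 T y\<close> holds without any error term
  (\<open>arcsq_derivative_bound\<close>), and the argument applies to the matrix polynomial \<open>T (Y Q)\<close>, whose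
  derivative under the trace is elementary (\<open>sqrt_trace_arcsq_le_length\<close>). The same equation shows that
  \<open>T (1 - cos \<theta>)\<close> eventually exceeds \<open>\<theta>\<^sup>2 - \<epsilon>\<close> (\<open>arcsq_eventually_ge\<close>). Finally, for involutions
  belonging to projections \<open>P\<close> and \<open>R\<close> one has \<open>Y Q = 2 (P - R)\<^sup>2\<close>, and the traces of its powers
  are expressed by the principal angles (\<open>trace_mpow_cos_defect_frames\<close>).
\<close>

section \<open>Matrix algebra, traces and the Frobenius inner product\<close>

lemma bounded_bilinear_matrix_mult:
  "bounded_bilinear ((**) :: real^'n^'m \<Rightarrow> real^'k^'n \<Rightarrow> real^'k^'m)"
  unfolding bilinear_conv_bounded_bilinear[symmetric] bilinear_def linear_iff
  by (simp add: matrix_matrix_mult_def vec_eq_iff sum.distrib sum_distrib_left algebra_simps)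

lemmas matrix_mult_bilinear =
  bounded_bilinear.add_left[OF bounded_bilinear_matrix_mult]
  bounded_bilinear.add_right[OF bounded_bilinear_matrix_mult]
  bounded_bilinear.diff_left[OF bounded_bilinear_matrix_mult]
  bounded_bilinear.diff_right[OF bounded_bilinear_matrix_mult]
  bounded_bilinear.scaleR_left[OF bounded_bilinear_matrix_mult]
  bounded_bilinear.scaleR_right[OF bounded_bilinear_matrix_mult]
  bounded_bilinear.minus_left[OF bounded_bilinear_matrix_mult]
  bounded_bilinear.minus_right[OF bounded_bilinear_matrix_mult]
  bounded_bilinear.zero_left[OF bounded_bilinear_matrix_mult]
  bounded_bilinear.zero_right[OF bounded_bilinear_matrix_mult]

lemma bounded_linear_transpose: "bounded_linear (transpose :: real^'n^'m \<Rightarrow> real^'m^'n)"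
  by (rule linear_conv_bounded_linear[THEN iffD1])
     (auto simp: linear_iff transpose_def vec_eq_iff)

lemma transpose_linear:
  fixes A B :: "real^'n^'m"
  shows "transpose (A + B) = transpose A + transpose B"
    and "transpose (A - B) = transpose A - transpose B"
    and "transpose (- A) = - transpose A"
    and "transpose (c *\<^sub>R A) = c *\<^sub>R transpose A"
    and "transpose (0 :: real^'n^'m) = 0"
  by (auto simp: transpose_def vec_eq_iff)

lemma transpose_inner: "(transpose A *v x) \<bullet> y = x \<bullet> (A *v y)" for A :: "real^'n^'m"
  by (simp add: dot_lmul_matrix)

lemma bounded_linear_trace: "bounded_linear (trace :: real^'n^'n \<Rightarrow> real)"
  by (rule linear_conv_bounded_linear[THEN iffD1])
     (auto simp: linear_iff trace_def sum.distrib sum_distrib_left)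

lemma trace_scaleR: "trace (c *\<^sub>R A) = c * trace A" for A :: "real^'n^'n"
  by (simp add: trace_def sum_distrib_left)

lemma trace_minus: "trace (- A) = - trace A" for A :: "real^'n^'n"
  by (simp add: trace_def sum_negf)

lemma trace_transpose: "trace (transpose A) = trace A"
  by (simp add: trace_def transpose_def)

lemma inner_matrix_eq_trace: "A \<bullet> B = trace (transpose A ** B)" for A B :: "real^'n^'m"
  unfolding trace_def inner_vec_def matrix_matrix_mult_def transpose_def
  by (subst sum.swap) simp

section \<open>Orthonormal families and the spectral theorem\<close>

definition orthonormal_family :: "'i set \<Rightarrow> ('i \<Rightarrow> 'a::real_inner) \<Rightarrow> bool" where
  "orthonormal_family J e \<longleftrightarrow> (\<forall>i\<in>J. \<forall>j\<in>J. e i \<bullet> e j = (if i = j then 1 else 0))"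

lemma ex_unit_orthogonal:
  fixes e :: "'i \<Rightarrow> 'a::euclidean_space"
  assumes "finite J" "card J < DIM('a)"
  obtains u where "norm u = 1" "\<And>j. j \<in> J \<Longrightarrow> e j \<bullet> u = 0"
proof -
  have "dim (e ` J) \<le> card J"
    using assms(1) by (meson card_image_le dim_le_card' finite_imageI le_trans)
  then obtain x where x: "x \<noteq> 0" "\<And>y. y \<in> span (e ` J) \<Longrightarrow> orthogonal x y"
    using orthogonal_to_subspace_exists[of "e ` J"] assms(2) by (metis le_less_trans)
  show thesis
  proof (rule that[of "x /\<^sub>R norm x"])
    fix j assume "j \<in> J"
    then have "orthogonal x (e j)" using x(2) by (auto intro: span_base)
    then show "e j \<bullet> (x /\<^sub>R norm x) = 0" by (simp add: orthogonal_def inner_commute)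
  qed (use x(1) in simp)
qed

lemma orthonormal_family_insert:
  assumes "orthonormal_family J e" "k \<notin> J" "norm u = 1" "\<And>j. j \<in> J \<Longrightarrow> e j \<bullet> u = 0"
  shows "orthonormal_family (insert k J) (e(k := u))"
proof -
  have "u \<bullet> u = 1" using assms(3) by (simp add: dot_square_norm)
  moreover have "u \<bullet> e j = 0" if "j \<in> J" for j using assms(4)[OF that] by (simp add: inner_commute)
  ultimately show ?thesis using assms(1,2,4) unfolding orthonormal_family_def by auto
qed

lemma orthonormal_family_extend:
  fixes e :: "'n::finite \<Rightarrow> real^'n"
  assumes "orthonormal_family J e"
  obtains f where "orthonormal_family UNIV f" "\<And>j. j \<in> J \<Longrightarrow> f j = e j"
proof -
  have "\<exists>f. orthonormal_family (J \<union> K) f \<and> (\<forall>j\<in>J. f j = e j)" if "finite K" for K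
    using that
  proof (induction K)
    case empty then show ?case using assms by auto
  next
    case (insert k K)
    then obtain f where f: "orthonormal_family (J \<union> K) f" "\<forall>j\<in>J. f j = e j" by auto
    show ?case
    proof (cases "k \<in> J \<union> K")
      case True then show ?thesis using f by (metis Un_insert_right insert_absorb)
    next
      case False
      have "card (J \<union> K) < CARD('n)"
        by (rule psubset_card_mono) (use False in auto)
      then obtain u where "norm u = 1" "\<And>j. j \<in> J \<union> K \<Longrightarrow> f j \<bullet> u = 0"
        using ex_unit_orthogonal[of "J \<union> K" f] by auto
      then have "orthonormal_family (J \<union> insert k K) (f(k := u))"
        using orthonormal_family_insert[OF f(1) False] by auto
      moreover have "\<forall>j\<in>J. (f(k := u)) j = e j" using False f(2) by auto
      ultimately show ?thesis by blast
    qed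
  qed
  from this[of UNIV] show thesis using that by auto
qed

lemma symmetric_inner: "transpose S = S \<Longrightarrow> (S *v x) \<bullet> y = x \<bullet> (S *v y)" for S :: "real^'n^'n"
  by (metis transpose_inner)

text \<open>A maximiser \<open>u\<close> of the quadratic form on the unit sphere of an invariant subspace \<open>C\<close> is an
  eigenvector: if the residual \<open>w = S u - \<mu> u\<close> were nonzero, moving from \<open>u\<close> a little in the
  direction \<open>w\<close>, which stays inside \<open>C\<close>, would increase the Rayleigh quotient to first order.\<close>

lemma symmetric_eigenvector_in_subspace:
  fixes S :: "real^'n^'n"
  assumes S: "transpose S = S" and C: "subspace C" and inv: "\<And>x. x \<in> C \<Longrightarrow> S *v x \<in> C"
    and ne: "\<exists>u\<in>C. norm u = 1"
  obtains u \<mu> where "u \<in> C" "norm u = 1" "S *v u = \<mu> *\<^sub>R u"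
proof -
  let ?q = "\<lambda>x. x \<bullet> (S *v x)"
  have "compact (C \<inter> sphere 0 1)"
    using C by (intro closed_Int_compact closed_subspace) auto
  moreover have "C \<inter> sphere 0 1 \<noteq> {}" using ne by auto
  moreover have "continuous_on (C \<inter> sphere 0 1) ?q"
    by (intro continuous_intros linear_continuous_on matrix_vector_mul_bounded_linear)
  ultimately obtain u where u0: "u \<in> C \<inter> sphere 0 1"
    and max0: "\<forall>y\<in>C \<inter> sphere 0 1. ?q y \<le> ?q u"
    using continuous_attains_sup[of "C \<inter> sphere 0 1" ?q] by blast
  then have u: "u \<in> C" "norm u = 1"
    and max: "\<And>y. y \<in> C \<Longrightarrow> norm y = 1 \<Longrightarrow> ?q y \<le> ?q u" by auto
  define \<mu> where "\<mu> = ?q u"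
  have le: "?q y \<le> \<mu> * (y \<bullet> y)" if "y \<in> C" for y
  proof (cases "y = 0")
    case False
    have "?q (y /\<^sub>R norm y) \<le> \<mu>"
      unfolding \<mu>_def using that C False by (intro max) (auto intro: subspace_scale)
    then have "?q y / (norm y)\<^sup>2 \<le> \<mu>"
      by (simp add: matrix_vector_mult_scaleR power2_eq_square divide_simps)
    then show ?thesis using False
      by (simp add: pos_divide_le_eq dot_square_norm)
  qed simp
  define w where "w = S *v u - \<mu> *\<^sub>R u"
  have w: "w \<in> C" unfolding w_def using C u inv by (auto intro: subspace_diff subspace_scale)
  define c where "c = \<mu> * (w \<bullet> w) - ?q w"
  have wu: "w \<bullet> (S *v u) - \<mu> * (w \<bullet> u) = w \<bullet> w"
    by (simp add: w_def algebra_simps)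
  have uu: "u \<bullet> u = 1" using u(2) by (simp add: dot_square_norm)
  have key: "2 * t * (w \<bullet> w) \<le> t\<^sup>2 * c" for t
  proof -
    have "u + t *\<^sub>R w \<in> C" using C u w by (auto intro: subspace_add subspace_scale)
    from le[OF this] have "?q (u + t *\<^sub>R w) \<le> \<mu> * ((u + t *\<^sub>R w) \<bullet> (u + t *\<^sub>R w))" .
    moreover have "?q (u + t *\<^sub>R w) = \<mu> + 2 * t * (w \<bullet> (S *v u)) + t\<^sup>2 * ?q w"
      using symmetric_inner[OF S, of u w]
      by (simp add: \<mu>_def matrix_vector_right_distrib matrix_vector_mult_scaleR inner_add_left
          inner_add_right inner_commute power2_eq_square algebra_simps)
    moreover have "(u + t *\<^sub>R w) \<bullet> (u + t *\<^sub>R w) = 1 + 2 * t * (w \<bullet> u) + t\<^sup>2 * (w \<bullet> w)"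
      by (simp add: uu inner_add_left inner_add_right inner_commute power2_eq_square algebra_simps)
    ultimately have "\<mu> + 2 * t * (w \<bullet> (S *v u)) + t\<^sup>2 * ?q w
        \<le> \<mu> * (1 + 2 * t * (w \<bullet> u) + t\<^sup>2 * (w \<bullet> w))" by simp
    then have "2 * t * (w \<bullet> (S *v u) - \<mu> * (w \<bullet> u)) \<le> t\<^sup>2 * c"
      unfolding c_def by (simp add: algebra_simps)
    then show ?thesis by (simp only: wu)
  qed
  have "w \<bullet> w \<le> 0"
  proof (rule ccontr)
    assume a: "\<not> w \<bullet> w \<le> 0"
    define t where "t = (w \<bullet> w) / (\<bar>c\<bar> + 1)"
    have t: "t > 0" unfolding t_def using a by (intro divide_pos_pos) auto
    have "t * c \<le> t * (\<bar>c\<bar> + 1)" using t by (intro mult_left_mono) auto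
    also have "\<dots> = w \<bullet> w" by (simp add: t_def)
    finally have "t * (t * c) \<le> t * (w \<bullet> w)" using t by (intro mult_left_mono) auto
    moreover have "t * (w \<bullet> w) > 0" using t a by (intro mult_pos_pos) auto
    ultimately show False using key[of t] by (simp add: power2_eq_square algebra_simps)
  qed
  then have "w = 0" by (metis inner_eq_zero_iff inner_ge_zero order_antisym)
  then show thesis using that[of u \<mu>] u by (simp add: w_def)
qed

text \<open>The orthogonal complement of eigenvectors of a symmetric matrix is invariant, so as long as it is
  nonzero it contains a further eigenvector.\<close>

theorem symmetric_matrix_eigenbasis:
  fixes S :: "real^'n^'n"
  assumes S: "transpose S = S"
  obtains e d where "orthonormal_family (UNIV :: 'n set) e" "\<And>i. S *v e i = d i *\<^sub>R e i"
proof -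
  have "\<exists>e d. orthonormal_family J e \<and> (\<forall>j\<in>J. S *v e j = d j *\<^sub>R e j)" if "finite J"
    for J :: "'n set"
    using that
  proof (induction J)
    case empty then show ?case by (auto simp: orthonormal_family_def)
  next
    case (insert k J)
    then obtain e d where e: "orthonormal_family J e" and d: "\<And>j. j \<in> J \<Longrightarrow> S *v e j = d j *\<^sub>R e j"
      by auto
    have "card J < CARD('n)" by (rule psubset_card_mono) (use insert in auto)
    then obtain v where v: "norm v = 1" "\<And>j. j \<in> J \<Longrightarrow> e j \<bullet> v = 0"
      using ex_unit_orthogonal[of J e] by auto
    define C where "C = {x. \<forall>j\<in>J. e j \<bullet> x = 0}"
    have C: "subspace C" by (auto simp: C_def subspace_def inner_add_right)
    have inv: "S *v x \<in> C" if "x \<in> C" for x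
      using that d by (simp add: C_def symmetric_inner[OF S, symmetric])
    obtain u \<mu> where u: "u \<in> C" "norm u = 1" "S *v u = \<mu> *\<^sub>R u"
      by (rule symmetric_eigenvector_in_subspace[OF S C inv]) (use v in \<open>auto simp: C_def\<close>)
    show ?case
    proof (intro exI conjI)
      show "orthonormal_family (insert k J) (e(k := u))"
        using orthonormal_family_insert[OF e] insert u by (auto simp: C_def)
      show "\<forall>j\<in>insert k J. S *v (e(k := u)) j = (d(k := \<mu>)) j *\<^sub>R (e(k := u)) j"
        using u d insert by auto
    qed
  qed
  from this[of UNIV] show thesis using that by auto
qed

text \<open>Mediates between orthonormal families, in which eigenvectors are found, and matrices,
  in which products and traces are computed.\<close>

definition mat_of_cols :: "('m \<Rightarrow> real^'p) \<Rightarrow> real^'m^'p" where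
  "mat_of_cols e = (\<chi> i j. e j $ i)"

lemma column_mat_of_cols [simp]: "column j (mat_of_cols e) = e j"
  by (simp add: mat_of_cols_def column_def vec_eq_iff)

lemma gram_component: "(transpose A ** B) $ i $ j = column i A \<bullet> column j B" for A B :: "real^'n^'m"
  by (simp add: matrix_matrix_mult_def transpose_def column_def inner_vec_def)

lemma orthonormal_family_iff_gram:
  "orthonormal_family UNIV (\<lambda>i. column i A) \<longleftrightarrow> transpose A ** A = mat 1" for A :: "real^'m^'p"
  by (auto simp: orthonormal_family_def vec_eq_iff gram_component mat_def)

lemma column_matrix_mult: "column j (A ** B) = A *v column j B" for A :: "real^'n^'m"
  by (simp add: column_def matrix_matrix_mult_def matrix_vector_mult_def vec_eq_iff)

lemma trace_orthonormal:
  fixes X :: "real^'n^'n"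
  assumes "orthonormal_family (UNIV :: 'n set) e"
  shows "trace X = (\<Sum>j\<in>UNIV. e j \<bullet> (X *v e j))"
proof -
  define A where "A = mat_of_cols e"
  have "transpose A ** A = mat 1"
    using assms by (simp add: A_def flip: orthonormal_family_iff_gram)
  then have "A ** transpose A = mat 1"
    using matrix_left_right_inverse by blast
  then have "trace X = trace (X ** (A ** transpose A))" by simp
  also have "\<dots> = trace (transpose A ** (X ** A))"
    by (subst matrix_mul_assoc) (rule trace_mul_sym)
  also have "\<dots> = (\<Sum>j\<in>UNIV. e j \<bullet> (X *v e j))"
    by (simp add: trace_def gram_component column_matrix_mult A_def)
  finally show ?thesis .
qed

lemma norm_matrix_orthonormal:
  fixes X :: "real^'n^'n"
  assumes "orthonormal_family (UNIV :: 'n set) e"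
  shows "(norm X)\<^sup>2 = (\<Sum>j\<in>UNIV. (norm (X *v e j))\<^sup>2)"
proof -
  have "(norm X)\<^sup>2 = trace (transpose X ** X)"
    by (simp add: dot_square_norm flip: inner_matrix_eq_trace)
  also have "\<dots> = (\<Sum>j\<in>UNIV. e j \<bullet> ((transpose X ** X) *v e j))"
    by (rule trace_orthonormal[OF assms])
  also have "\<dots> = (\<Sum>j\<in>UNIV. (norm (X *v e j))\<^sup>2)"
  proof (rule sum.cong[OF refl])
    fix j
    have "e j \<bullet> ((transpose X ** X) *v e j) = e j \<bullet> (transpose X *v (X *v e j))"
      by (simp only: matrix_vector_mul_assoc)
    also have "\<dots> = (X *v e j) \<bullet> (X *v e j)"
      by (simp only: inner_commute[of "e j"] transpose_inner)
    finally show "e j \<bullet> ((transpose X ** X) *v e j) = (norm (X *v e j))\<^sup>2"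
      by (simp only: dot_square_norm)
  qed
  finally show ?thesis .
qed

section \<open>Truncating the power series of the squared arccosine\<close>

text \<open>The coefficients of the power series of \<open>(arccos (1 - y))\<^sup>2\<close>; for \<open>n > 0\<close> they equal
  \<open>2 ^ (n + 1) * (n!)\<^sup>2 / (n\<^sup>2 * (2 * n)!)\<close>. The recursion is the form in which the
  differential equation of that function determines them.\<close>

fun arcsq_coeff :: "nat \<Rightarrow> real" where
  "arcsq_coeff 0 = 0"
| "arcsq_coeff (Suc 0) = 2"
| "arcsq_coeff (Suc (Suc n)) =
     (real (Suc n))\<^sup>2 * arcsq_coeff (Suc n) / (real (n + 2) * real (2 * n + 3))"

definition arcsq :: "nat \<Rightarrow> real \<Rightarrow> real" where
  "arcsq N y = (\<Sum>n\<le>N. arcsq_coeff n * y ^ n)"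

definition arcsq' :: "nat \<Rightarrow> real \<Rightarrow> real" where
  "arcsq' N y = (\<Sum>n\<le>N. arcsq_coeff n * (real n * y ^ (n - 1)))"

definition arcsq'' :: "nat \<Rightarrow> real \<Rightarrow> real" where
  "arcsq'' N y = (\<Sum>n\<le>N. arcsq_coeff n * (real n * (real (n - 1) * y ^ (n - 2))))"

lemma arcsq_coeff_nonneg: "0 \<le> arcsq_coeff n"
  by (induction n rule: arcsq_coeff.induct) auto

lemma arcsq_coeff_rec:
  assumes "0 < n"
  shows "real (n + 1) * real (2 * n + 1) * arcsq_coeff (Suc n) = (real n)\<^sup>2 * arcsq_coeff n"
proof -
  obtain k where "n = Suc k" using assms by (cases n) auto
  then show ?thesis by (simp add: divide_simps) (simp add: algebra_simps)?
qed

lemma arcsq_has_derivative: "(arcsq N has_real_derivative arcsq' N y) (at y)"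
proof -
  have "((\<lambda>y. \<Sum>n\<le>N. arcsq_coeff n * y ^ n) has_real_derivative arcsq' N y) (at y)"
    unfolding arcsq'_def by (auto intro!: derivative_eq_intros sum.cong)
  then show ?thesis by (simp add: arcsq_def[abs_def])
qed

lemma arcsq'_has_derivative: "(arcsq' N has_real_derivative arcsq'' N y) (at y)"
proof -
  have "((\<lambda>y. \<Sum>n\<le>N. arcsq_coeff n * (real n * y ^ (n - 1))) has_real_derivative arcsq'' N y) (at y)"
    unfolding arcsq''_def
    by (auto intro!: derivative_eq_intros sum.cong simp: numeral_2_eq_2 diff_Suc split: nat.splits)
  then show ?thesis by (simp add: arcsq'_def[abs_def])
qed

lemma arcsq_0 [simp]: "arcsq N 0 = 0"
  unfolding arcsq_def by (rule sum.neutral) (metis arcsq_coeff.simps(1) bot_nat_0.not_eq_extremum mult_zero_left mult_zero_right zero_power)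

lemma arcsq'_nonneg: "0 \<le> y \<Longrightarrow> 0 \<le> arcsq' N y"
  unfolding arcsq'_def by (intro sum_nonneg mult_nonneg_nonneg arcsq_coeff_nonneg) auto

lemma arcsq_mono: "0 \<le> x \<Longrightarrow> x \<le> y \<Longrightarrow> arcsq N x \<le> arcsq N y"
  unfolding arcsq_def by (intro sum_mono mult_left_mono power_mono arcsq_coeff_nonneg) auto

lemma arcsq_nonneg: "0 \<le> y \<Longrightarrow> 0 \<le> arcsq N y"
  using arcsq_mono[of 0 y N] by simp

text \<open>The function \<open>g y = (arccos (1 - y))\<^sup>2\<close> solves \<open>y (2 - y) g'' + (1 - y) g' = 2\<close>; its
  coefficient recursion makes all but one term of the residual of a truncation cancel.\<close>

lemma arcsq_ode:
  assumes "0 < N"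
  shows "y * (2 - y) * arcsq'' N y + (1 - y) * arcsq' N y
    = 2 - (real N)\<^sup>2 * arcsq_coeff N * y ^ N"
  using assms
proof (induction N rule: nat_induct_non_zero)
  case 1
  then show ?case by (simp add: arcsq'_def arcsq''_def)
next
  case (Suc N)
  obtain k where k: "N = Suc k" using Suc(1) by (cases N) auto
  let ?a = "arcsq_coeff (Suc N)"
  have "y * (2 - y) * arcsq'' (Suc N) y + (1 - y) * arcsq' (Suc N) y =
      2 - (real N)\<^sup>2 * arcsq_coeff N * y ^ N
      + (y * (2 - y) * (?a * (real (N + 1) * (real N * y ^ k))) + (1 - y) * (?a * (real (N + 1) * y ^ N)))"
    using Suc(2) by (simp add: arcsq'_def arcsq''_def k algebra_simps del: arcsq_coeff.simps)
  also have "y * (2 - y) * (?a * (real (N + 1) * (real N * y ^ k))) + (1 - y) * (?a * (real (N + 1) * y ^ N))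
      = real (N + 1) * real (2 * N + 1) * ?a * y ^ N - (real (Suc N))\<^sup>2 * ?a * y ^ Suc N"
    by (simp add: k algebra_simps power2_eq_square del: arcsq_coeff.simps)
  also have "real (N + 1) * real (2 * N + 1) * ?a = (real N)\<^sup>2 * arcsq_coeff N"
    by (rule arcsq_coeff_rec[OF Suc(1)])
  finally show ?case by (simp del: arcsq_coeff.simps)
qed

text \<open>For the full series this is the equation \<open>(d (\<theta>\<^sup>2) / d \<theta>)\<^sup>2 = 4 \<theta>\<^sup>2\<close> with
  \<open>y = 1 - cos \<theta>\<close>. The sign of the residual of the truncated differential equation turns the
  equation into an inequality.\<close>

lemma arcsq_derivative_bound:
  assumes "0 \<le> y"
  shows "y * (2 - y) * (arcsq' N y)\<^sup>2 \<le> 4 * arcsq N y"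
proof (cases "N = 0")
  case True
  then show ?thesis by (simp add: arcsq'_def arcsq_def)
next
  case False
  define E where "E = (\<lambda>y. y * (2 - y) * (arcsq' N y)\<^sup>2 - 4 * arcsq N y)"
  have "(E has_real_derivative - 2 * arcsq' N x * ((real N)\<^sup>2 * arcsq_coeff N * x ^ N)) (at x)" for x
  proof -
    have "(E has_real_derivative
        2 * arcsq' N x * (x * (2 - x) * arcsq'' N x + (1 - x) * arcsq' N x) - 4 * arcsq' N x) (at x)"
      unfolding E_def
      by (rule derivative_eq_intros arcsq_has_derivative arcsq'_has_derivative refl)+
         (simp add: algebra_simps power2_eq_square)
    then have "(E has_real_derivative
        2 * arcsq' N x * (2 - (real N)\<^sup>2 * arcsq_coeff N * x ^ N) - 4 * arcsq' N x) (at x)"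
      using False by (simp only: arcsq_ode neq0_conv)
    then show ?thesis by (simp add: algebra_simps)
  qed
  then have "E y \<le> E 0"
    using assms by (intro DERIV_nonpos_imp_nonincreasing[of 0 y E])
      (force intro!: mult_nonneg_nonneg arcsq'_nonneg arcsq_coeff_nonneg)+
  then show ?thesis by (simp add: E_def)
qed

text \<open>The left-hand side grows by the factor \<open>(2 n + 2) / (2 n + 1)\<close> from \<open>n\<close> to \<open>n + 1\<close>, hence at
  most linearly. So the residual of the truncated equation vanishes in the limit for \<open>y < 2\<close>.\<close>

lemma arcsq_residual_bound: "0 < n \<Longrightarrow> (real n)\<^sup>2 * arcsq_coeff n * 2 ^ n \<le> 4 * real n"
proof (induction n rule: nat_induct_non_zero)
  case 1 then show ?case by simp
next
  case (Suc n)
  define b where "b = (real n)\<^sup>2 * arcsq_coeff n * 2 ^ n"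
  have b0: "0 \<le> b" by (simp add: b_def arcsq_coeff_nonneg)
  have "(real (Suc n))\<^sup>2 * arcsq_coeff (Suc n) * 2 ^ Suc n * real (2 * n + 1)
    = real (n + 1) * 2 ^ Suc n * (real (n + 1) * real (2 * n + 1) * arcsq_coeff (Suc n))"
    by (simp add: power2_eq_square algebra_simps)
  also have "\<dots> = b * (2 * real n + 2)"
    unfolding arcsq_coeff_rec[OF Suc(1)] b_def by (simp add: algebra_simps)
  also have "\<dots> \<le> 4 * real n * (2 * real n + 2)"
    using Suc(2) by (intro mult_right_mono) (auto simp: b_def)
  also have "\<dots> \<le> 4 * real (Suc n) * real (2 * n + 1)"
    by (simp add: algebra_simps)
  finally show ?case by (subst (asm) mult_le_cancel_right) auto
qed

lemma arcsq_residual_tendsto_0: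
  assumes "0 \<le> y" "y < 2"
  shows "(\<lambda>n. (real n)\<^sup>2 * arcsq_coeff n * y ^ n) \<longlonglongrightarrow> 0"
proof (rule tendsto_sandwich[of "\<lambda>_. 0"])
  show "(\<lambda>n. 4 * (real n * (y / 2) ^ n)) \<longlonglongrightarrow> 0"
    using assms by (intro tendsto_mult_right_zero powser_times_n_limit_0) auto
  show "\<forall>\<^sub>F n in sequentially. 0 \<le> (real n)\<^sup>2 * arcsq_coeff n * y ^ n"
    using assms by (simp add: arcsq_coeff_nonneg)
  show "\<forall>\<^sub>F n in sequentially. (real n)\<^sup>2 * arcsq_coeff n * y ^ n \<le> 4 * (real n * (y / 2) ^ n)"
    using eventually_gt_at_top[of 0]
  proof eventually_elim
    case (elim n)
    have "(real n)\<^sup>2 * arcsq_coeff n * y ^ n = ((real n)\<^sup>2 * arcsq_coeff n * 2 ^ n) * (y / 2) ^ n"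
      by (simp add: power_divide)
    also have "\<dots> \<le> 4 * real n * (y / 2) ^ n"
      using assms arcsq_residual_bound[OF elim] by (intro mult_right_mono) auto
    finally show ?case by simp
  qed
qed simp

text \<open>In the variable \<open>\<theta>\<close> the differential equation reads \<open>\<tau>'' = 2 - residual\<close> for
  \<open>\<tau> \<theta> = arcsq N (1 - cos \<theta>)\<close>, and can be integrated twice.\<close>

lemma arcsq_lower_bound:
  assumes N: "0 < N" and \<theta>: "0 \<le> \<theta>" "\<theta> \<le> pi"
    and res: "(real N)\<^sup>2 * arcsq_coeff N * (1 - cos \<theta>) ^ N \<le> \<epsilon>"
  shows "(1 - \<epsilon> / 2) * \<theta>\<^sup>2 \<le> arcsq N (1 - cos \<theta>)"
proof -
  define r where "r = (\<lambda>t. (real N)\<^sup>2 * arcsq_coeff N * (1 - cos t) ^ N)"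
  define F where "F = (\<lambda>t. arcsq' N (1 - cos t) * sin t - (2 - \<epsilon>) * t)"
  define G where "G = (\<lambda>t. arcsq N (1 - cos t) - (1 - \<epsilon> / 2) * t\<^sup>2)"
  have r: "r t \<le> \<epsilon>" if "0 \<le> t" "t \<le> \<theta>" for t
  proof -
    have "cos \<theta> \<le> cos t" using that \<theta> by (intro cos_monotone_0_pi_le) auto
    then have "r t \<le> r \<theta>" unfolding r_def
      by (intro mult_left_mono power_mono) (auto simp: arcsq_coeff_nonneg)
    then show ?thesis using res by (simp add: r_def)
  qed
  have F': "(F has_real_derivative \<epsilon> - r t) (at t)" for t
  proof -
    have "((\<lambda>t. arcsq' N (1 - cos t)) has_real_derivative arcsq'' N (1 - cos t) * sin t) (at t)"
      by (rule DERIV_chain2[OF arcsq'_has_derivative]) (auto intro!: derivative_eq_intros)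
    then have "(F has_real_derivative
        (sin t * sin t) * arcsq'' N (1 - cos t) + cos t * arcsq' N (1 - cos t) - (2 - \<epsilon>)) (at t)"
      unfolding F_def by (auto intro!: derivative_eq_intros)
    moreover have "sin t * sin t = (1 - cos t) * (2 - (1 - cos t))"
      using sin_cos_squared_add[of t] by (simp add: algebra_simps power2_eq_square)
    ultimately have "(F has_real_derivative
        (1 - cos t) * (2 - (1 - cos t)) * arcsq'' N (1 - cos t)
        + (1 - (1 - cos t)) * arcsq' N (1 - cos t) - (2 - \<epsilon>)) (at t)"
      by simp
    then show ?thesis unfolding arcsq_ode[OF N] by (simp add: r_def)
  qed
  have F: "0 \<le> F t" if t: "0 \<le> t" "t \<le> \<theta>" for t
  proof -
    have "F 0 \<le> F t"
    proof (rule DERIV_nonneg_imp_nondecreasing[OF t(1)])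
      fix s assume "0 \<le> s" "s \<le> t"
      then show "\<exists>d. (F has_real_derivative d) (at s) \<and> 0 \<le> d"
        using F'[of s] r[of s] t by (intro exI[of _ "\<epsilon> - r s"]) auto
    qed
    then show ?thesis by (simp add: F_def)
  qed
  have "G 0 \<le> G \<theta>"
  proof (rule DERIV_nonneg_imp_nondecreasing[OF \<theta>(1)])
    fix s assume s: "0 \<le> s" "s \<le> \<theta>"
    have "((\<lambda>t. arcsq N (1 - cos t)) has_real_derivative arcsq' N (1 - cos s) * sin s) (at s)"
      by (rule DERIV_chain2[OF arcsq_has_derivative]) (auto intro!: derivative_eq_intros)
    then have "(G has_real_derivative F s) (at s)"
      unfolding G_def F_def by (auto intro!: derivative_eq_intros simp: algebra_simps)
    then show "\<exists>d. (G has_real_derivative d) (at s) \<and> 0 \<le> d" using F[OF s] by blast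
  qed
  then show ?thesis by (simp add: G_def)
qed

lemma arcsq_eventually_ge_aux:
  assumes \<theta>: "0 \<le> \<theta>" "\<theta> < pi" and "0 < \<epsilon>"
  shows "\<forall>\<^sub>F N in sequentially. \<theta>\<^sup>2 - \<epsilon> \<le> arcsq N (1 - cos \<theta>)"
proof -
  define \<delta> where "\<delta> = \<epsilon> / (\<theta>\<^sup>2 + 1)"
  have \<delta>: "0 < \<delta>" using assms by (auto simp: \<delta>_def intro!: divide_pos_pos add_nonneg_pos)
  have "cos pi < cos \<theta>" using \<theta> by (intro cos_monotone_0_pi) auto
  then have "(\<lambda>n. (real n)\<^sup>2 * arcsq_coeff n * (1 - cos \<theta>) ^ n) \<longlonglongrightarrow> 0"
    by (intro arcsq_residual_tendsto_0) auto
  then have "\<forall>\<^sub>F n in sequentially. (real n)\<^sup>2 * arcsq_coeff n * (1 - cos \<theta>) ^ n < \<delta>"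
    using \<delta> by (rule order_tendstoD(2))
  then show ?thesis
    using eventually_gt_at_top[of 0]
  proof eventually_elim
    case (elim N)
    have "\<delta> * \<theta>\<^sup>2 \<le> \<delta> * (\<theta>\<^sup>2 + 1)" using \<delta> by (intro mult_left_mono) auto
    also have "\<dots> = \<epsilon>"
      unfolding \<delta>_def using zero_le_power2[of \<theta>] by (simp add: add_nonneg_eq_0_iff)
    finally have "\<delta> / 2 * \<theta>\<^sup>2 \<le> \<epsilon>" using \<open>0 < \<epsilon>\<close> by simp
    moreover have "(1 - \<delta> / 2) * \<theta>\<^sup>2 \<le> arcsq N (1 - cos \<theta>)"
      using \<theta> elim by (intro arcsq_lower_bound) auto
    ultimately show ?case by (simp add: algebra_simps)
  qed
qed

lemma arcsq_eventually_ge: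
  assumes \<theta>: "0 \<le> \<theta>" "\<theta> \<le> pi" and \<epsilon>: "0 < \<epsilon>"
  shows "\<forall>\<^sub>F N in sequentially. \<theta>\<^sup>2 - \<epsilon> \<le> arcsq N (1 - cos \<theta>)"
proof (cases "\<theta> = 0")
  case True
  then show ?thesis using \<epsilon> by simp
next
  case False
  \<comment> \<open>The residual does not vanish in the limit at \<open>\<theta> = \<pi>\<close>, so \<open>\<theta>\<close> is approached from below.\<close>
  define \<theta>' where "\<theta>' = max 0 (\<theta> - \<epsilon> / (4 * \<theta>))"
  have t: "0 < \<theta>" using False \<theta> by simp
  have *: "0 \<le> \<theta>'" "\<theta>' < \<theta>" using t \<epsilon> by (auto simp: \<theta>'_def)
  have "\<theta> - \<theta>' \<le> \<epsilon> / (4 * \<theta>)" by (simp add: \<theta>'_def)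
  then have "(\<theta> - \<theta>') * (\<theta> + \<theta>') \<le> \<epsilon> / (4 * \<theta>) * (2 * \<theta>)"
    using * t \<epsilon> by (intro mult_mono) auto
  then have sq: "\<theta>\<^sup>2 - \<epsilon> / 2 \<le> \<theta>'\<^sup>2"
    using t by (simp add: power2_eq_square algebra_simps)
  have "cos \<theta> \<le> cos \<theta>'" using * \<theta> by (intro cos_monotone_0_pi_le) auto
  then have mono: "arcsq N (1 - cos \<theta>') \<le> arcsq N (1 - cos \<theta>)" for N
    by (intro arcsq_mono) auto
  have "\<forall>\<^sub>F N in sequentially. \<theta>'\<^sup>2 - \<epsilon> / 2 \<le> arcsq N (1 - cos \<theta>')"
    using * \<theta> \<epsilon> by (intro arcsq_eventually_ge_aux) auto
  then show ?thesis
  proof eventually_elim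
    case (elim N)
    then show ?case using sq mono[of N] by linarith
  qed
qed

section \<open>Polynomials in a symmetric matrix\<close>

primrec mpow :: "real^'n^'n \<Rightarrow> nat \<Rightarrow> real^'n^'n" where
  "mpow Y 0 = mat 1"
| "mpow Y (Suc n) = Y ** mpow Y n"

lemma mpow_add: "mpow Y (m + n) = mpow Y m ** mpow Y n"
  by (induction m) (simp_all add: matrix_mul_assoc)

lemma mpow_intertwine:
  fixes A :: "real^'n^'m"
  assumes "A ** B = C ** A"
  shows "A ** mpow B n = mpow C n ** A"
proof (induction n)
  case (Suc n)
  have "A ** mpow B (Suc n) = (A ** B) ** mpow B n" by (simp add: matrix_mul_assoc)
  also have "\<dots> = C ** (A ** mpow B n)" by (simp add: assms matrix_mul_assoc)
  also have "\<dots> = mpow C (Suc n) ** A" by (simp add: Suc matrix_mul_assoc)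
  finally show ?case .
qed simp

lemma mpow_Suc_right: "mpow Y (Suc n) = mpow Y n ** Y"
  using mpow_intertwine[of Y Y Y n] by simp

lemma transpose_mpow: "transpose (mpow Y n) = mpow (transpose Y) n"
proof (induction n)
  case (Suc n)
  have "transpose (mpow Y (Suc n)) = transpose (mpow Y n) ** transpose Y"
    by (simp add: matrix_transpose_mul)
  then show ?case using mpow_Suc_right[of "transpose Y" n] Suc by simp
qed simp

lemma mpow_eigenvector: "Y *v x = d *\<^sub>R x \<Longrightarrow> mpow Y n *v x = (d ^ n) *\<^sub>R x"
  by (induction n)
    (simp_all add: matrix_vector_mult_scaleR mult.commute flip: matrix_vector_mul_assoc)

lemma mpow_scaleR: "mpow (c *\<^sub>R Y) n = (c ^ n) *\<^sub>R mpow Y n"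
  by (induction n) (simp_all add: matrix_mult_bilinear mult.commute)

lemma mpow_0_left: "mpow 0 n = (if n = 0 then mat 1 else 0)"
  by (cases n) (simp_all add: matrix_mult_bilinear)

lemma sum_matrix_vector: "(\<Sum>i\<in>I. A i) *v x = (\<Sum>i\<in>I. A i *v x)" for A :: "_ \<Rightarrow> real^'n^'m"
  by (induction I rule: infinite_finite_induct) (simp_all add: matrix_vector_mult_add_rdistrib)

lemma trace_mpow_eigenbasis:
  fixes Y :: "real^'n^'n"
  assumes "orthonormal_family (UNIV :: 'n set) e" "\<And>i. Y *v e i = d i *\<^sub>R e i"
  shows "trace (mpow Y n) = (\<Sum>i\<in>UNIV. d i ^ n)"
  using assms(1)
  by (simp add: trace_orthonormal[OF assms(1)] mpow_eigenvector[OF assms(2)] orthonormal_family_def)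

definition arcsq_mat :: "nat \<Rightarrow> real^'n^'n \<Rightarrow> real^'n^'n" where
  "arcsq_mat N Y = (\<Sum>n\<le>N. arcsq_coeff n *\<^sub>R mpow Y n)"

definition arcsq_mat' :: "nat \<Rightarrow> real^'n^'n \<Rightarrow> real^'n^'n" where
  "arcsq_mat' N Y = (\<Sum>n\<le>N. (arcsq_coeff n * real n) *\<^sub>R mpow Y (n - 1))"

lemma trace_sum: "trace (\<Sum>i\<in>I. A i) = (\<Sum>i\<in>I. trace (A i))" for A :: "_ \<Rightarrow> real^'n^'n"
  by (rule linear_sum[OF bounded_linear.linear[OF bounded_linear_trace]])

lemma trace_arcsq_mat: "trace (arcsq_mat N Y) = (\<Sum>n\<le>N. arcsq_coeff n * trace (mpow Y n))"
  by (simp add: arcsq_mat_def trace_sum trace_scaleR)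

lemma trace_arcsq_mat_eigenbasis:
  fixes Y :: "real^'n^'n"
  assumes "orthonormal_family (UNIV :: 'n set) e" "\<And>i. Y *v e i = d i *\<^sub>R e i"
  shows "trace (arcsq_mat N Y) = (\<Sum>i\<in>UNIV. arcsq N (d i))"
  unfolding trace_arcsq_mat trace_mpow_eigenbasis[OF assms] arcsq_def sum_distrib_left
  by (rule sum.swap)

lemma arcsq_mat'_eigenvector:
  assumes "Y *v x = d *\<^sub>R x"
  shows "arcsq_mat' N Y *v x = arcsq' N d *\<^sub>R x"
  by (simp add: arcsq_mat'_def arcsq'_def sum_matrix_vector mpow_eigenvector[OF assms] scaleR_sum_left
      mult.assoc flip: scaleR_matrix_vector_assoc)

lemma matrix_mult_sum_right: "A ** (\<Sum>i\<in>I. B i) = (\<Sum>i\<in>I. A ** B i)" for A :: "real^'n^'m"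
  by (rule bounded_bilinear.sum_right[OF bounded_bilinear_matrix_mult])

lemma matrix_mult_sum_left: "(\<Sum>i\<in>I. B i) ** A = (\<Sum>i\<in>I. B i ** A)" for A :: "real^'n^'m"
  by (rule bounded_bilinear.sum_left[OF bounded_bilinear_matrix_mult])

lemma arcsq_mat'_commute: "A ** Y = Y ** A \<Longrightarrow> A ** arcsq_mat' N Y = arcsq_mat' N Y ** A"
  by (simp add: arcsq_mat'_def matrix_mult_sum_left matrix_mult_sum_right matrix_mult_bilinear
      mpow_intertwine[of A Y Y])

lemma transpose_arcsq_mat': "transpose Y = Y \<Longrightarrow> transpose (arcsq_mat' N Y) = arcsq_mat' N Y"
  by (simp add: arcsq_mat'_def transpose_mpow transpose_linear
      linear_sum[OF bounded_linear.linear[OF bounded_linear_transpose]])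

text \<open>The derivative of \<open>Y\<^sup>n\<close> is a sum of \<open>n\<close> noncommuting products, but under the trace the
  factors can be rotated, so that it behaves like a scalar.\<close>

lemma mpow_has_vector_derivative:
  fixes Y :: "real \<Rightarrow> real^'n^'n"
  assumes "(Y has_vector_derivative Y') (at t within S)"
  obtains D where "((\<lambda>t. mpow (Y t) n) has_vector_derivative D) (at t within S)"
    and "\<And>k. trace (mpow (Y t) k ** D) = real n * trace (mpow (Y t) (k + n - 1) ** Y')"
proof -
  have "\<exists>D. ((\<lambda>t. mpow (Y t) n) has_vector_derivative D) (at t within S) \<and>
    (\<forall>k. trace (mpow (Y t) k ** D) = real n * trace (mpow (Y t) (k + n - 1) ** Y'))"
  proof (induction n)
    case 0
    show ?case
      by (rule exI[of _ 0]) (simp add: matrix_mult_bilinear trace_def)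
  next
    case (Suc n)
    then obtain D where D: "((\<lambda>t. mpow (Y t) n) has_vector_derivative D) (at t within S)"
      and tr: "\<And>k. trace (mpow (Y t) k ** D) = real n * trace (mpow (Y t) (k + n - 1) ** Y')"
      by blast
    have "((\<lambda>t. mpow (Y t) (Suc n)) has_vector_derivative (Y t ** D + Y' ** mpow (Y t) n))
      (at t within S)"
      using bounded_bilinear.has_vector_derivative[OF bounded_bilinear_matrix_mult assms D]
      by simp
    moreover have "trace (mpow (Y t) k ** (Y t ** D + Y' ** mpow (Y t) n))
      = real (Suc n) * trace (mpow (Y t) (k + Suc n - 1) ** Y')" for k
    proof -
      have "trace (mpow (Y t) k ** (Y t ** D)) = trace (mpow (Y t) (Suc k) ** D)"
        by (simp only: mpow_Suc_right matrix_mul_assoc)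
      also have "\<dots> = real n * trace (mpow (Y t) (k + n) ** Y')" by (simp only: tr) simp
      finally have 1: "trace (mpow (Y t) k ** (Y t ** D)) = real n * trace (mpow (Y t) (k + n) ** Y')" .
      have "trace (mpow (Y t) k ** (Y' ** mpow (Y t) n))
        = trace (mpow (Y t) n ** (mpow (Y t) k ** Y'))"
        by (subst matrix_mul_assoc) (rule trace_mul_sym)
      also have "\<dots> = trace (mpow (Y t) (k + n) ** Y')"
        by (simp add: matrix_mul_assoc add.commute[of k] flip: mpow_add)
      finally show ?thesis using 1
        by (simp add: matrix_mult_bilinear trace_add algebra_simps)
    qed
    ultimately show ?case by blast
  qed
  then show thesis using that by blast
qed

lemma trace_arcsq_mat_has_derivative:
  fixes Y :: "real \<Rightarrow> real^'n^'n"
  assumes "(Y has_vector_derivative Y') (at t within S)"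
  shows "((\<lambda>t. trace (arcsq_mat N (Y t))) has_vector_derivative
    trace (arcsq_mat' N (Y t) ** Y')) (at t within S)"
proof -
  have "((\<lambda>t. trace (mpow (Y t) n)) has_vector_derivative real n * trace (mpow (Y t) (n - 1) ** Y'))
    (at t within S)" for n
  proof -
    obtain D where D: "((\<lambda>t. mpow (Y t) n) has_vector_derivative D) (at t within S)"
      and tr: "\<And>k. trace (mpow (Y t) k ** D) = real n * trace (mpow (Y t) (k + n - 1) ** Y')"
      using mpow_has_vector_derivative[OF assms, of n] by blast
    show ?thesis
      using bounded_linear.has_vector_derivative[OF bounded_linear_trace D] tr[of 0] by simp
  qed
  then have "((\<lambda>t. \<Sum>n\<le>N. arcsq_coeff n * trace (mpow (Y t) n)) has_vector_derivative
    (\<Sum>n\<le>N. arcsq_coeff n * (real n * trace (mpow (Y t) (n - 1) ** Y')))) (at t within S)"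
    by (intro has_vector_derivative_sum has_vector_derivative_mult_right)
  then show ?thesis
    by (simp add: trace_arcsq_mat arcsq_mat'_def matrix_mult_sum_left trace_sum
        matrix_mult_bilinear trace_scaleR mult.assoc)
qed

section \<open>The length of a path of orthogonal matrices\<close>

text \<open>A rotation by the angle \<open>\<theta>\<close> in a plane contributes the eigenvalue \<open>1 - cos \<theta>\<close>, twice, to this
  symmetric matrix. The trace of \<open>(arccos (1 - y))\<^sup>2\<close> at it is thus the sum of the squares
  of all eigenangles of \<open>Q\<close>.\<close>

definition cos_defect :: "real^'n^'n \<Rightarrow> real^'n^'n" where
  "cos_defect Q = mat 1 - (1/2) *\<^sub>R (Q + transpose Q)"

lemma transpose_cos_defect: "transpose (cos_defect Q) = cos_defect Q"
  by (simp add: cos_defect_def transpose_linear add.commute)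

lemma orthogonal_matrixD:
  assumes "orthogonal_matrix (Q :: real^'n^'n)"
  shows "transpose Q ** Q = mat 1" "Q ** transpose Q = mat 1"
  using assms by (auto simp: orthogonal_matrix_def)

lemma orthogonal_matrix_inner:
  assumes "orthogonal_matrix (Q :: real^'n^'n)"
  shows "(Q *v x) \<bullet> (Q *v y) = x \<bullet> y" "(transpose Q *v x) \<bullet> (transpose Q *v y) = x \<bullet> y"
proof -
  have "x \<bullet> (transpose Q *v (Q *v y)) = x \<bullet> y" "x \<bullet> (Q *v (transpose Q *v y)) = x \<bullet> y"
    by (simp_all only: matrix_vector_mul_assoc orthogonal_matrixD[OF assms] matrix_vector_mul_lid)
  then show "(Q *v x) \<bullet> (Q *v y) = x \<bullet> y" "(transpose Q *v x) \<bullet> (transpose Q *v y) = x \<bullet> y"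
    by (simp_all only: transpose_inner[symmetric] transpose_transpose)
qed

text \<open>With \<open>d = 1 - cos \<theta>\<close>, the square of \<open>Q\<close> turns \<open>e\<close> by the angle \<open>2 \<theta>\<close>, and the chord from \<open>e\<close> to
  its image has length \<open>2 sin \<theta>\<close>, whose square is \<open>4 d (2 - d)\<close>.\<close>

lemma cos_defect_eigenvalue:
  assumes Q: "orthogonal_matrix (Q :: real^'n^'n)" and e: "e \<bullet> e = 1"
    and d: "cos_defect Q *v e = d *\<^sub>R e"
  shows "0 \<le> d" and "(norm (e - Q *v (Q *v e)))\<^sup>2 = 4 * (d * (2 - d))"
proof -
  have eq: "Q *v e + transpose Q *v e = (2 * (1 - d)) *\<^sub>R e"
  proof -
    have "cos_defect Q *v e = e - (1/2) *\<^sub>R (Q *v e + transpose Q *v e)"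
      by (simp only: cos_defect_def matrix_vector_mult_diff_rdistrib matrix_vector_mul_lid
          matrix_vector_mult_add_rdistrib flip: scaleR_matrix_vector_assoc)
    then have "(1/2) *\<^sub>R (Q *v e + transpose Q *v e) = e - d *\<^sub>R e"
      using d by (simp only: algebra_simps)
    then have "2 *\<^sub>R ((1/2) *\<^sub>R (Q *v e + transpose Q *v e)) = 2 *\<^sub>R (e - d *\<^sub>R e)"
      by (simp only:)
    then have "Q *v e + transpose Q *v e = 2 *\<^sub>R (e - d *\<^sub>R e)"
      by (simp only: scaleR_scaleR) simp
    also have "\<dots> = (2 * (1 - d)) *\<^sub>R e" by (simp add: algebra_simps)
    finally show ?thesis .
  qed
  have QT: "(Q *v x) \<bullet> y = x \<bullet> (transpose Q *v y)" for x y
    by (metis transpose_inner transpose_transpose)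
  have "2 * (1 - d) = e \<bullet> (Q *v e + transpose Q *v e)"
    unfolding eq using e by simp
  also have "\<dots> = 2 * (e \<bullet> (Q *v e))"
    by (simp only: inner_add_right inner_commute[of e "transpose Q *v e"] transpose_inner)
  also have "\<dots> \<le> 2 * (norm e * norm (Q *v e))"
    using norm_cauchy_schwarz[of e "Q *v e"] by simp
  also have "\<dots> = 2"
    using e orthogonal_matrix_inner(1)[OF Q, of e e] by (simp add: norm_eq_sqrt_inner)
  finally show "0 \<le> d" by simp
  have "(norm (Q *v e + transpose Q *v e))\<^sup>2 = 2 + 2 * ((Q *v e) \<bullet> (transpose Q *v e))"
    unfolding dot_square_norm[symmetric] inner_add_left inner_add_right orthogonal_matrix_inner[OF Q] e
    by (simp only: inner_commute[of "transpose Q *v e"])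
  also have "(Q *v e) \<bullet> (transpose Q *v e) = (Q *v (Q *v e)) \<bullet> e"
    by (simp only: QT)
  finally have 1: "(2 * (1 - d))\<^sup>2 = 2 + 2 * ((Q *v (Q *v e)) \<bullet> e)"
    unfolding eq using e by (simp add: norm_eq_sqrt_inner power_mult_distrib)
  have "(norm (e - Q *v (Q *v e)))\<^sup>2 = 2 - 2 * ((Q *v (Q *v e)) \<bullet> e)"
    unfolding dot_square_norm[symmetric] inner_diff_left inner_diff_right orthogonal_matrix_inner[OF Q] e
    by (simp only: inner_commute[of e])
  then show "(norm (e - Q *v (Q *v e)))\<^sup>2 = 4 * (d * (2 - d))"
    using 1 by (simp add: power2_eq_square algebra_simps)
qed

lemma trace_arcsq_mat_cos_defect_nonneg:
  assumes Q: "orthogonal_matrix (Q :: real^'n^'n)"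
  shows "0 \<le> trace (arcsq_mat N (cos_defect Q))"
proof -
  obtain e d where e: "orthonormal_family (UNIV :: 'n set) e"
    and d: "\<And>i. cos_defect Q *v e i = d i *\<^sub>R e i"
    using symmetric_matrix_eigenbasis[OF transpose_cos_defect] by blast
  have "0 \<le> d i" for i
    by (rule cos_defect_eigenvalue(1)[OF Q _ d]) (use e in \<open>auto simp: orthonormal_family_def\<close>)
  then show ?thesis
    unfolding trace_arcsq_mat_eigenbasis[OF e d] by (intro sum_nonneg arcsq_nonneg)
qed

text \<open>The matrix \<open>K = arcsq_mat' N (cos_defect Q)\<close> commutes with \<open>Q\<close>, and only its component
  \<open>Z\<close> tangent to the orthogonal group at \<open>Q\<close> pairs with the tangent vector \<open>X\<close>. On an eigenvector
  of \<open>cos_defect Q\<close>, the norm of \<open>Z\<close> is \<open>sqrt (d (2 - d))\<close> times the derivative of \<open>arcsq N\<close>,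
  which the scalar inequality controls by \<open>2 sqrt (arcsq N d)\<close>; summing the squares over an
  eigenbasis bounds \<open>Z\<close>.\<close>

lemma trace_arcsq_mat_cos_defect_derivative_bound:
  fixes Q X :: "real^'n^'n"
  assumes Q: "orthogonal_matrix Q"
    and tangent: "transpose X ** Q + transpose Q ** X = 0"
  shows "\<bar>trace (arcsq_mat' N (cos_defect Q) ** (- (1/2) *\<^sub>R (X + transpose X)))\<bar>
    \<le> 2 * sqrt (trace (arcsq_mat N (cos_defect Q))) * norm X"
proof -
  obtain e d where e: "orthonormal_family (UNIV :: 'n set) e"
    and d: "\<And>i. cos_defect Q *v e i = d i *\<^sub>R e i"
    using symmetric_matrix_eigenbasis[OF transpose_cos_defect] by blast
  define K where "K = arcsq_mat' N (cos_defect Q)"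
  have Ksym: "transpose K = K"
    unfolding K_def by (rule transpose_arcsq_mat'[OF transpose_cos_defect])
  have KQ: "Q ** K = K ** Q"
    unfolding K_def
    by (rule arcsq_mat'_commute)
      (simp add: cos_defect_def matrix_mult_bilinear orthogonal_matrixD[OF Q])
  define Z where "Z = (1/2) *\<^sub>R ((mat 1 - Q ** Q) ** K)"
  \<comment> \<open>Tangency exchanges \<open>X\<close> with its transpose, which allows to average two expressions for the
    same trace and so to project \<open>K\<close> to the tangent space.\<close>
  have XT: "transpose X = - (transpose Q ** X ** transpose Q)"
  proof -
    have "transpose X = (transpose X ** Q) ** transpose Q"
      by (simp add: orthogonal_matrixD[OF Q] flip: matrix_mul_assoc)
    also have "transpose X ** Q = - (transpose Q ** X)"
      using tangent by (simp add: eq_neg_iff_add_eq_0)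
    finally show ?thesis by (simp add: matrix_mult_bilinear)
  qed
  have tr1: "trace (K ** transpose X) = trace (K ** X)"
  proof -
    have "trace (K ** transpose X) = trace (transpose (X ** K))"
      by (simp add: matrix_transpose_mul Ksym)
    also have "\<dots> = trace (K ** X)" unfolding trace_transpose by (rule trace_mul_sym)
    finally show ?thesis .
  qed
  have tr2: "trace (K ** transpose X) = - trace (transpose ((Q ** Q) ** K) ** X)"
  proof -
    have "trace (K ** transpose X) = - trace ((K ** transpose Q ** X) ** transpose Q)"
      by (simp add: XT matrix_mult_bilinear matrix_mul_assoc trace_def sum_negf)
    also have "trace ((K ** transpose Q ** X) ** transpose Q) = trace ((transpose Q ** K ** transpose Q) ** X)"
      by (subst trace_mul_sym) (simp add: matrix_mul_assoc)
    also have "transpose Q ** K ** transpose Q = transpose (Q ** K ** Q)"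
      by (simp add: matrix_transpose_mul Ksym matrix_mul_assoc)
    also have "Q ** K ** Q = (Q ** Q) ** K"
      by (simp only: KQ[symmetric] matrix_mul_assoc[symmetric])
    finally show ?thesis .
  qed
  have "Z \<bullet> X = (1/2) * (trace (K ** X) - trace (transpose ((Q ** Q) ** K) ** X))"
    by (simp add: Z_def inner_matrix_eq_trace matrix_mult_bilinear transpose_linear trace_scaleR
        trace_sub Ksym)
  then have ZX: "Z \<bullet> X = trace (K ** X)" using tr1 tr2 by simp
  have "trace (K ** (- (1/2) *\<^sub>R (X + transpose X))) = - trace (K ** X)"
    using tr1 by (simp add: matrix_mult_bilinear trace_scaleR trace_add trace_minus)
  then have "\<bar>trace (K ** (- (1/2) *\<^sub>R (X + transpose X)))\<bar> = \<bar>Z \<bullet> X\<bar>" by (simp add: ZX)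
  also have "\<dots> \<le> norm Z * norm X" by (rule Cauchy_Schwarz_ineq2)
  also have "norm Z \<le> 2 * sqrt (trace (arcsq_mat N (cos_defect Q)))"
  proof -
    have "(norm (Z *v e i))\<^sup>2 \<le> 4 * arcsq N (d i)" for i
    proof -
      have ee: "e i \<bullet> e i = 1" using e by (auto simp: orthonormal_family_def)
      have "Z *v e i = (arcsq' N (d i) / 2) *\<^sub>R (e i - Q *v (Q *v e i))"
        by (simp add: Z_def K_def arcsq_mat'_eigenvector[OF d] matrix_vector_mult_scaleR
            matrix_vector_mult_diff_rdistrib flip: matrix_vector_mul_assoc scaleR_matrix_vector_assoc)
      then have "(norm (Z *v e i))\<^sup>2 = (arcsq' N (d i))\<^sup>2 / 4 * (norm (e i - Q *v (Q *v e i)))\<^sup>2"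
        by (simp add: power_mult_distrib power_divide)
      also have "\<dots> = d i * (2 - d i) * (arcsq' N (d i))\<^sup>2"
        unfolding cos_defect_eigenvalue(2)[OF Q ee d] by simp
      also have "\<dots> \<le> 4 * arcsq N (d i)"
        by (rule arcsq_derivative_bound[OF cos_defect_eigenvalue(1)[OF Q ee d]])
      finally show ?thesis .
    qed
    then have "(norm Z)\<^sup>2 \<le> 4 * trace (arcsq_mat N (cos_defect Q))"
      unfolding norm_matrix_orthonormal[OF e] trace_arcsq_mat_eigenbasis[OF e d] sum_distrib_left
      by (intro sum_mono)
    then have "norm Z \<le> sqrt (4 * trace (arcsq_mat N (cos_defect Q)))"
      by (rule real_le_rsqrt)
    then show ?thesis by (simp add: real_sqrt_mult)
  qed
  finally show ?thesis by (simp add: K_def mult_right_mono)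
qed

lemma orthogonal_matrix_transpose_mult:
  fixes U V :: "real^'n^'n"
  shows "orthogonal_matrix U \<Longrightarrow> orthogonal_matrix V \<Longrightarrow> orthogonal_matrix (transpose U ** V)"
  by (rule orthogonal_matrix_mul) (auto simp: orthogonal_matrix_transpose)

lemma norm_orthogonal_mult:
  fixes U X :: "real^'n^'n"
  assumes "orthogonal_matrix U"
  shows "norm (transpose U ** X) = norm X"
proof -
  have "transpose (transpose U ** X) ** (transpose U ** X) = transpose X ** (U ** transpose U) ** X"
    by (simp add: matrix_transpose_mul matrix_mul_assoc)
  then have "(transpose U ** X) \<bullet> (transpose U ** X) = X \<bullet> X"
    using assms by (simp add: inner_matrix_eq_trace orthogonal_matrixD)
  then show ?thesis by (simp add: norm_eq_sqrt_inner)
qed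

lemma orthogonal_path_tangent:
  fixes \<gamma> :: "real \<Rightarrow> real^'n^'n"
  assumes orth: "\<And>t. t \<in> {a..b} \<Longrightarrow> orthogonal_matrix (\<gamma> t)"
    and der: "(\<gamma> has_vector_derivative X) (at t within {a..b})" and t: "t \<in> {a..b}" and "a < b"
  shows "transpose X ** \<gamma> t + transpose (\<gamma> t) ** X = 0"
proof -
  have "((\<lambda>t. transpose (\<gamma> t) ** \<gamma> t) has_vector_derivative
      transpose (\<gamma> t) ** X + transpose X ** \<gamma> t) (at t within {a..b})"
    by (rule bounded_bilinear.has_vector_derivative[OF bounded_bilinear_matrix_mult
          bounded_linear.has_vector_derivative[OF bounded_linear_transpose der] der])
  then have "((\<lambda>t. mat 1) has_vector_derivative transpose (\<gamma> t) ** X + transpose X ** \<gamma> t)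
      (at t within {a..b})"
    by (rule has_vector_derivative_transform[OF t, rotated]) (simp add: orthogonal_matrixD[OF orth])
  moreover have "((\<lambda>t. mat 1 :: real^'n^'n) has_vector_derivative 0) (at t within {a..b})"
    by (rule has_vector_derivative_const)
  ultimately have "transpose (\<gamma> t) ** X + transpose X ** \<gamma> t = 0"
    using t \<open>a < b\<close> by (intro vector_derivative_unique_within[of t "{a..b}"])
      (auto simp: trivial_limit_within islimpt_Icc)
  then show ?thesis by (simp add: add.commute)
qed

lemma cos_defect_mat_1: "cos_defect (mat 1) = 0"
  by (simp add: cos_defect_def scaleR_2 flip: scaleR_add_right)

text \<open>\<open>sqrt F\<close> may fail to be differentiable where \<open>F\<close> vanishes, as it does at the starting
  point of the path; adding a positive constant under the root repairs this.\<close>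

lemma sqrt_le_integral:
  fixes F f v :: "real \<Rightarrow> real"
  assumes F0: "F 0 = 0" and nonneg: "\<And>t. t \<in> {0..1} \<Longrightarrow> 0 \<le> F t"
    and der: "\<And>t. t \<in> {0..1} \<Longrightarrow> (F has_vector_derivative f t) (at t within {0..1})"
    and bound: "\<And>t. t \<in> {0..1} \<Longrightarrow> \<bar>f t\<bar> \<le> 2 * sqrt (F t) * v t"
    and v: "v integrable_on {0..1}" "\<And>t. t \<in> {0..1} \<Longrightarrow> 0 \<le> v t"
  shows "sqrt (F 1) \<le> integral {0..1} v"
proof (rule field_le_epsilon)
  fix \<epsilon> :: real assume \<epsilon>: "0 < \<epsilon>"
  define h where "h = (\<lambda>t. sqrt (F t + \<epsilon>\<^sup>2))"
  have pos: "0 < F t + \<epsilon>\<^sup>2" if "t \<in> {0..1}" for t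
    using nonneg[OF that] \<epsilon> by (intro add_nonneg_pos) auto
  have hder: "(h has_vector_derivative f t / (2 * h t)) (at t within {0..1})" if "t \<in> {0..1}" for t
  proof -
    have "(F has_real_derivative f t) (at t within {0..1})"
      using der[OF that] by (simp add: has_real_derivative_iff_has_vector_derivative)
    then have "(h has_real_derivative f t / (2 * h t)) (at t within {0..1})"
      unfolding h_def using pos[OF that]
      by (auto intro!: derivative_eq_intros simp: divide_simps)
    then show ?thesis by (simp add: has_real_derivative_iff_has_vector_derivative)
  qed
  have int: "((\<lambda>t. f t / (2 * h t)) has_integral (h 1 - h 0)) {0..1}"
    by (rule fundamental_theorem_of_calculus) (auto intro: hder)
  have "h 1 - h 0 \<le> integral {0..1} v"
  proof (rule has_integral_le[OF int integrable_integral[OF v(1)]])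
    fix t :: real assume t: "t \<in> {0..1}"
    have h: "0 < h t" "sqrt (F t) \<le> h t" using pos[OF t] by (auto simp: h_def)
    have "f t \<le> 2 * sqrt (F t) * v t" using bound[OF t] by linarith
    also have "\<dots> \<le> 2 * h t * v t" using h v(2)[OF t] by (intro mult_right_mono) auto
    finally show "f t / (2 * h t) \<le> v t" using h by (simp add: divide_simps mult.commute)
  qed
  moreover have "h 0 = \<epsilon>" using \<epsilon> by (simp add: h_def F0)
  moreover have "sqrt (F 1) \<le> h 1" by (simp add: h_def)
  ultimately show "sqrt (F 1) \<le> integral {0..1} v + \<epsilon>" by simp
qed

text \<open>The root of the sum of the squared eigenangles is a 1-Lipschitz function on the orthogonal group
  with the Frobenius metric; this is the version for the truncated series, which is smooth also
  where an eigenangle reaches \<open>\<pi>\<close>.\<close>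

theorem sqrt_trace_arcsq_le_length:
  fixes \<gamma> :: "real \<Rightarrow> real^'n^'n"
  assumes orth: "\<And>t. t \<in> {0..1} \<Longrightarrow> orthogonal_matrix (\<gamma> t)"
    and der: "\<And>t. t \<in> {0..1} \<Longrightarrow> (\<gamma> has_vector_derivative D t) (at t within {0..1})"
    and cont: "continuous_on {0..1} D"
  shows "sqrt (trace (arcsq_mat N (cos_defect (transpose (\<gamma> 0) ** \<gamma> 1))))
    \<le> integral {0..1} (\<lambda>t. norm (D t))"
proof -
  define U where "U = transpose (\<gamma> 0)"
  define Q where "Q t = U ** \<gamma> t" for t
  define X where "X t = U ** D t" for t
  have orth0: "orthogonal_matrix (\<gamma> 0)" by (rule orth) simp
  have Qorth: "orthogonal_matrix (Q t)" if "t \<in> {0..1}" for t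
    unfolding Q_def U_def by (rule orthogonal_matrix_transpose_mult[OF orth0 orth[OF that]])
  have Qder: "(Q has_vector_derivative X t) (at t within {0..1})" if "t \<in> {0..1}" for t
    unfolding Q_def[abs_def] X_def
    by (rule bounded_linear.has_vector_derivative[OF
          bounded_bilinear.bounded_linear_right[OF bounded_bilinear_matrix_mult] der[OF that]])
  have Yder: "((\<lambda>t. cos_defect (Q t)) has_vector_derivative - (1/2) *\<^sub>R (X t + transpose (X t)))
      (at t within {0..1})" if "t \<in> {0..1}" for t
  proof -
    note Qder[OF that]
    note this[THEN bounded_linear.has_vector_derivative[OF bounded_linear_transpose]]
    then have "((\<lambda>t. (1/2) *\<^sub>R (Q t + transpose (Q t))) has_vector_derivative
        (1/2) *\<^sub>R (X t + transpose (X t))) (at t within {0..1})"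
      using Qder[OF that]
      by (intro bounded_linear.has_vector_derivative[OF bounded_linear_scaleR_right]
          has_vector_derivative_add)
    from has_vector_derivative_diff[OF has_vector_derivative_const[of "mat 1"] this]
    show ?thesis by (simp add: cos_defect_def)
  qed
  have "sqrt (trace (arcsq_mat N (cos_defect (Q 1)))) \<le> integral {0..1} (\<lambda>t. norm (D t))"
  proof (rule sqrt_le_integral)
    have "Q 0 = mat 1" by (simp add: Q_def U_def orthogonal_matrixD[OF orth0])
    then show "trace (arcsq_mat N (cos_defect (Q 0))) = 0"
      unfolding trace_arcsq_mat
      by (auto simp: cos_defect_mat_1 mpow_0_left trace_def intro!: sum.neutral)
    fix t :: real assume t: "t \<in> {0..1}"
    show "0 \<le> trace (arcsq_mat N (cos_defect (Q t)))"
      by (rule trace_arcsq_mat_cos_defect_nonneg[OF Qorth[OF t]])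
    show "((\<lambda>t. trace (arcsq_mat N (cos_defect (Q t)))) has_vector_derivative
        trace (arcsq_mat' N (cos_defect (Q t)) ** (- (1/2) *\<^sub>R (X t + transpose (X t)))))
        (at t within {0..1})"
      by (rule trace_arcsq_mat_has_derivative[OF Yder[OF t]])
    have "norm (X t) = norm (D t)"
      unfolding X_def U_def by (rule norm_orthogonal_mult[OF orth0])
    moreover have "transpose (X t) ** Q t + transpose (Q t) ** X t = 0"
      by (rule orthogonal_path_tangent[OF Qorth Qder[OF t] t]) auto
    ultimately show "\<bar>trace (arcsq_mat' N (cos_defect (Q t)) ** (- (1/2) *\<^sub>R (X t + transpose (X t))))\<bar>
        \<le> 2 * sqrt (trace (arcsq_mat N (cos_defect (Q t)))) * norm (D t)"
      using trace_arcsq_mat_cos_defect_derivative_bound[OF Qorth[OF t], of "X t" N] by simp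
  qed (auto intro!: integrable_continuous_interval continuous_intros cont)
  then show ?thesis by (simp add: Q_def U_def)
qed

lemma SO_orthogonal: "U \<in> SO \<Longrightarrow> orthogonal_matrix U"
  by (simp add: SO_def rotation_matrix_def)

lemma matrix_inv_orthogonal:
  fixes U :: "real^'n^'n"
  assumes "orthogonal_matrix U"
  shows "matrix_inv U = transpose U"
proof -
  have "U ** matrix_inv U = mat 1 \<and> matrix_inv U ** U = mat 1"
    unfolding matrix_inv_def by (rule someI[of _ "transpose U"]) (simp add: orthogonal_matrixD[OF assms])
  then have "transpose U = (transpose U ** U) ** matrix_inv U"
    by (simp flip: matrix_mul_assoc)
  then show ?thesis by (simp add: orthogonal_matrixD[OF assms])
qed

lemma g_SO_at_tangent:
  fixes U X :: "real^'n^'n"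
  assumes U: "orthogonal_matrix U" and "transpose X ** U + transpose U ** X = 0"
  shows "g_SO_at U X X = (norm X)\<^sup>2 / 2"
proof -
  define A where "A = transpose U ** X"
  have "transpose A = - A"
    using assms(2) by (simp add: A_def matrix_transpose_mul eq_neg_iff_add_eq_0)
  then have "trace (A ** A) = - (A \<bullet> A)"
    by (simp add: inner_matrix_eq_trace matrix_mult_bilinear trace_def sum_negf)
  also have "A \<bullet> A = (norm X)\<^sup>2"
    using norm_orthogonal_mult[OF U, of X] by (simp add: A_def dot_square_norm)
  finally show ?thesis
    by (simp add: g_SO_at_def g_SO_def matrix_inv_orthogonal[OF U] A_def)
qed

lemma SO_pathE:
  assumes "SO_path \<gamma> U V"
  obtains D where "\<And>t. t \<in> {0..1} \<Longrightarrow> (\<gamma> has_vector_derivative D t) (at t)"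
    and "continuous_on {0..1} D" and "\<And>t. t \<in> {0..1} \<Longrightarrow> orthogonal_matrix (\<gamma> t)"
    and "SO_length \<gamma> = integral {0..1} (\<lambda>t. norm (D t)) / sqrt 2"
proof -
  obtain D where D: "\<And>t. t \<in> {0..1} \<Longrightarrow> (\<gamma> has_vector_derivative D t) (at t)"
    "continuous_on {0..1} D"
    using assms unfolding SO_path_def C1_differentiable_on_def by blast
  have orth: "orthogonal_matrix (\<gamma> t)" if "t \<in> {0..1}" for t
    using assms that by (intro SO_orthogonal) (auto simp: SO_path_def)
  have "SO_length \<gamma> = integral {0..1} (\<lambda>t. norm (D t) / sqrt 2)"
    unfolding SO_length_def
  proof (rule integral_cong)
    fix t :: real assume t: "t \<in> {0..1}"
    have "transpose (D t) ** \<gamma> t + transpose (\<gamma> t) ** D t = 0"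
      by (rule orthogonal_path_tangent[OF orth has_vector_derivative_at_within[OF D(1)[OF t]] t]) auto
    then show "sqrt (g_SO_at (\<gamma> t) (vector_derivative \<gamma> (at t)) (vector_derivative \<gamma> (at t)))
      = norm (D t) / sqrt 2"
      by (simp only: vector_derivative_at[OF D(1)[OF t]] g_SO_at_tangent[OF orth[OF t]]
          real_sqrt_divide real_sqrt_abs abs_norm_cancel)
  qed
  then show thesis by (intro that[of D] D orth) simp_all
qed

theorem SO_length_ge:
  assumes "SO_path \<gamma> U V"
  shows "trace (arcsq_mat N (cos_defect (transpose U ** V))) \<le> 2 * (SO_length \<gamma>)\<^sup>2"
proof -
  obtain D where D: "\<And>t. t \<in> {0..1} \<Longrightarrow> (\<gamma> has_vector_derivative D t) (at t)"
    "continuous_on {0..1} D" "\<And>t. t \<in> {0..1} \<Longrightarrow> orthogonal_matrix (\<gamma> t)"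
    and len: "SO_length \<gamma> = integral {0..1} (\<lambda>t. norm (D t)) / sqrt 2"
    using SO_pathE[OF assms] by blast
  have "sqrt (trace (arcsq_mat N (cos_defect (transpose (\<gamma> 0) ** \<gamma> 1)))) \<le> sqrt 2 * SO_length \<gamma>"
    using sqrt_trace_arcsq_le_length[of \<gamma> D N] D has_vector_derivative_at_within[OF D(1)] len by simp
  then have "trace (arcsq_mat N (cos_defect (transpose (\<gamma> 0) ** \<gamma> 1))) \<le> (sqrt 2 * SO_length \<gamma>)\<^sup>2"
    by (rule sqrt_le_D)
  then show ?thesis using assms by (simp add: SO_path_def power_mult_distrib)
qed

section \<open>Subspaces, their projections and their involutions\<close>

lemma range_eq_span_columns: "range ((*v) A) = span (columns A)" for A :: "real^'m^'p"
proof
  show "range ((*v) A) \<subseteq> span (columns A)"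
    using matrix_vector_mult_in_columnspace[of A] by auto
  have "column j A \<in> range ((*v) A)" for j
    by (metis matrix_vector_mult_basis rangeI)
  then have "columns A \<subseteq> range ((*v) A)" by (auto simp: columns_def)
  then show "span (columns A) \<subseteq> range ((*v) A)"
    by (intro span_minimal linear_subspace_image) auto
qed

lemma orthonormal_basis_of_iff:
  "orthonormal_basis_of A W \<longleftrightarrow> transpose A ** A = mat 1 \<and> range ((*v) A) = W"
  by (auto simp: orthonormal_basis_of_def range_eq_span_columns orthonormal_family_def
      simp flip: orthonormal_family_iff_gram)

lemma ex_orthonormal_basis_of:
  fixes W :: "(real^'p) set"
  assumes "W \<in> Gr CARD('m::finite)"
  shows "\<exists>A :: real^'m^'p. orthonormal_basis_of A W"
proof -
  from assms have W: "subspace W" "dim W = CARD('m)" by (auto simp: Gr_def)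
  obtain B where B: "pairwise orthogonal B" "\<And>x. x \<in> B \<Longrightarrow> norm x = 1" "independent B"
    "card B = dim W" "span B = W"
    using orthonormal_basis_subspace[OF W(1)] by blast
  have "finite B" using B(3) by (rule independent_imp_finite)
  then obtain e where e: "bij_betw e (UNIV :: 'm set) B"
    using finite_same_card_bij[of "UNIV :: 'm set" B] B(4) W(2) by auto
  have "e i \<bullet> e j = (if i = j then 1 else 0)" for i j
  proof (cases "i = j")
    case True
    have "norm (e i) = 1" using e by (intro B(2)) (auto simp: bij_betw_def)
    then show ?thesis using True by (simp add: dot_square_norm)
  next
    case False
    then have "e i \<noteq> e j" "e i \<in> B" "e j \<in> B" using e by (auto simp: bij_betw_def inj_def)
    then show ?thesis using B(1) False by (auto simp: pairwise_def orthogonal_def)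
  qed
  moreover have "columns (mat_of_cols e) = B" using e by (auto simp: columns_def bij_betw_def)
  ultimately have "orthonormal_basis_of (mat_of_cols e) W"
    using B(5) by (simp add: orthonormal_basis_of_def)
  then show ?thesis by blast
qed

lemma orth_proj_eqI:
  assumes W: "subspace W" and y: "y \<in> W" "\<And>w. w \<in> W \<Longrightarrow> orthogonal (x - y) w"
  shows "orth_proj W x = y"
  unfolding orth_proj_def
proof (rule the_equality)
  fix z assume z: "z \<in> W \<and> (\<forall>w\<in>W. orthogonal (x - z) w)"
  then have "z - y \<in> W" using W y(1) by (auto intro: subspace_diff)
  then have "(x - y) \<bullet> (z - y) = 0" "(x - z) \<bullet> (z - y) = 0"
    using z y(2) by (auto simp: orthogonal_def)
  then have "(z - y) \<bullet> (z - y) = 0" by (simp add: inner_diff_left)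
  then show "z = y" by simp
qed (use y in blast)

lemma orth_proj_orthonormal_basis:
  fixes A :: "real^'m^'p"
  assumes "orthonormal_basis_of A W"
  shows "orth_proj W x = (A ** transpose A) *v x"
proof -
  have A: "transpose A ** A = mat 1" "range ((*v) A) = W"
    using assms by (auto simp: orthonormal_basis_of_iff)
  show ?thesis
  proof (rule orth_proj_eqI)
    show "subspace W" using A(2) by (auto intro: linear_subspace_image)
    show "(A ** transpose A) *v x \<in> W"
      using A(2) by (auto simp flip: matrix_vector_mul_assoc)
    fix w assume "w \<in> W"
    then obtain y where y: "w = A *v y" using A(2) by auto
    have "(x - (A ** transpose A) *v x) \<bullet> (A *v y)
      = (transpose A *v (x - (A ** transpose A) *v x)) \<bullet> y"
      by (rule transpose_inner[symmetric])
    also have "transpose A *v (x - (A ** transpose A) *v x)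
      = transpose A *v x - (transpose A ** A ** transpose A) *v x"
      by (simp only: matrix_vector_mult_diff_distrib matrix_vector_mul_assoc matrix_mul_assoc)
    also have "\<dots> = 0" unfolding A(1) matrix_mul_lid by simp
    finally show "orthogonal (x - (A ** transpose A) *v x) w" by (simp add: y orthogonal_def)
  qed
qed

text \<open>\<open>Phi\<close> in terms of a frame: if the columns of \<open>A\<close> are orthonormal, \<open>A ** transpose A\<close> is the orthogonal
  projection onto their span.\<close>

definition frame_involution :: "real^'m^'p \<Rightarrow> real^'p^'p" where
  "frame_involution A = mat 1 - 2 *\<^sub>R (A ** transpose A)"

lemma Phi_orthonormal_basis:
  fixes A :: "real^'m^'p"
  assumes "orthonormal_basis_of A W"
  shows "Phi W = frame_involution A"
proof -
  have "orth_proj W = (*v) (A ** transpose A)"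
    using orth_proj_orthonormal_basis[OF assms] by auto
  then show ?thesis by (simp add: Phi_def frame_involution_def)
qed

lemma transpose_frame_involution: "transpose (frame_involution A) = frame_involution A"
  by (simp add: frame_involution_def transpose_linear matrix_transpose_mul)

lemma frame_projection_idem:
  assumes "transpose A ** A = mat 1"
  shows "(A ** transpose A) ** (A ** transpose A) = A ** transpose A"
proof -
  have "(A ** transpose A) ** (A ** transpose A) = A ** (transpose A ** A) ** transpose A"
    by (simp only: matrix_mul_assoc)
  then show ?thesis by (simp add: assms)
qed

lemma frame_involution_square:
  assumes "transpose A ** A = mat 1"
  shows "frame_involution A ** frame_involution A = mat 1"
  unfolding frame_involution_def
  by (simp add: matrix_mult_bilinear frame_projection_idem[OF assms] algebra_simps)

lemma frame_involution_orthogonal: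
  assumes "transpose A ** A = mat 1"
  shows "orthogonal_matrix (frame_involution A)"
  using frame_involution_square[OF assms]
  by (simp add: orthogonal_matrix_def transpose_frame_involution)

lemma ex_complex_structure:
  assumes "even CARD('m::finite)"
  shows "\<exists>J :: real^'m^'m. J ** J = - mat 1"
proof -
  obtain B :: "'m set" where B: "card B = CARD('m) div 2"
    using obtain_subset_with_card_n[of "CARD('m) div 2" "UNIV :: 'm set"] by auto
  have "card (- B) = card B"
    using assms B by (auto simp: Compl_eq_Diff_UNIV card_Diff_subset elim!: evenE)
  then obtain h where h: "bij_betw h B (- B)"
    using finite_same_card_bij[of B "- B"] by auto
  define k where "k = the_inv_into B h"
  have kh: "k (h i) = i" "h i \<notin> B" if "i \<in> B" for i
    using h that by (auto simp: k_def bij_betw_def the_inv_into_f_f)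
  have hk: "h (k i) = i" "k i \<in> B" if "i \<notin> B" for i
    using h that by (auto simp: k_def bij_betw_def f_the_inv_into_f the_inv_into_into)
  define f :: "real^'m \<Rightarrow> real^'m" where "f x = (\<chi> i. if i \<in> B then x $ h i else - (x $ k i))" for x
  have lin: "linear f" by (auto simp: f_def linear_iff vec_eq_iff)
  have "f (f x) = - x" for x
    by (auto simp: f_def vec_eq_iff kh hk)
  moreover have "(- mat 1) *v x = - x" for x :: "real^'m"
    using matrix_vector_mult_diff_rdistrib[of 0 "mat 1" x] by simp
  ultimately have "(matrix f ** matrix f) *v x = (- mat 1) *v x" for x
    by (simp add: matrix_works lin linear_matrix_vector_mul_eq flip: matrix_vector_mul_assoc)
  then show ?thesis by (metis matrix_eq)
qed

text \<open>A half turn on an even-dimensional subspace is the square of a quarter turn \<open>S\<close>, built from a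
  complex structure of the subspace, so its determinant \<open>(det S)\<^sup>2\<close> is not \<open>-1\<close>.\<close>

lemma frame_involution_SO:
  fixes A :: "real^'m^'p"
  assumes "even CARD('m)" and A: "transpose A ** A = mat 1"
  shows "frame_involution A \<in> SO"
proof -
  obtain J :: "real^'m^'m" where J: "J ** J = - mat 1" using ex_complex_structure[OF assms(1)] by blast
  have cancel: "X ** transpose A ** A = X" "X ** J ** J = - X" for X :: "real^'m^'k"
    using A J by (simp_all add: matrix_mult_bilinear flip: matrix_mul_assoc)
  define S where "S = mat 1 - A ** transpose A + A ** J ** transpose A"
  have "S ** S = frame_involution A"
    by (simp add: S_def frame_involution_def matrix_mult_bilinear matrix_mul_assoc cancel scaleR_2)
  then have "det (frame_involution A) = (det S)\<^sup>2" by (metis det_mul power2_eq_square)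
  then have "det (frame_involution A) \<noteq> -1" by (metis neg_0_le_iff_le not_one_le_zero zero_le_power2)
  then have "det (frame_involution A) = 1"
    using det_orthogonal_matrix[OF frame_involution_orthogonal[OF A]] by blast
  then show ?thesis
    using frame_involution_orthogonal[OF A] by (simp add: SO_def rotation_matrix_def)
qed

lemma frame_involution_eigenspace:
  fixes A :: "real^'m^'p"
  assumes A: "transpose A ** A = mat 1"
  shows "{x. frame_involution A *v x = - x} = range ((*v) A)"
proof -
  have eq: "frame_involution A *v x = x - 2 *\<^sub>R (A *v (transpose A *v x))" for x
    by (simp only: frame_involution_def matrix_vector_mult_diff_rdistrib matrix_vector_mul_lid
        matrix_vector_mul_assoc flip: scaleR_matrix_vector_assoc)
  show ?thesis
  proof (intro subset_antisym subsetI)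
    fix x assume "x \<in> {x. frame_involution A *v x = - x}"
    then have "2 *\<^sub>R (A *v (transpose A *v x)) = 2 *\<^sub>R x"
      unfolding eq mem_Collect_eq by (simp add: scaleR_2 algebra_simps)
    then have "x = A *v (transpose A *v x)" by simp
    then show "x \<in> range ((*v) A)" by blast
  next
    fix x assume "x \<in> range ((*v) A)"
    then obtain y where y: "x = A *v y" by blast
    have "transpose A *v x = y"
      by (simp only: y matrix_vector_mul_assoc A matrix_vector_mul_lid)
    then show "x \<in> {x. frame_involution A *v x = - x}"
      by (simp only: mem_Collect_eq eq y[symmetric]) (simp add: scaleR_2)
  qed
qed

lemma Phi_eigenspace:
  assumes "W \<in> Gr CARD('m::finite)"
  shows "{x. Phi W *v x = - x} = W"
proof -
  obtain A :: "real^'m^'a" where A: "orthonormal_basis_of A W"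
    using ex_orthonormal_basis_of[OF assms] by blast
  then show ?thesis
    using frame_involution_eigenspace[of A] by (simp add: Phi_orthonormal_basis[OF A] orthonormal_basis_of_iff)
qed

text \<open>An orthogonal involution is symmetric, so \<open>(x - R x) / 2\<close> and \<open>(x + R x) / 2\<close> are orthogonal
  components of \<open>x\<close> in its two eigenspaces.\<close>

lemma Phi_eigenspace_of_involution:
  fixes R :: "real^'p^'p"
  assumes "orthogonal_matrix R" "R ** R = mat 1"
  shows "Phi {x. R *v x = - x} = R"
proof -
  let ?W = "{x. R *v x = - x}"
  have "transpose R = transpose R ** (R ** R)" using assms(2) by simp
  also have "\<dots> = (transpose R ** R) ** R" by (simp only: matrix_mul_assoc)
  also have "\<dots> = R" using orthogonal_matrixD[OF assms(1)] by simp
  finally have sym: "transpose R = R" .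
  have RR: "R *v (R *v x) = x" for x by (simp add: matrix_vector_mul_assoc assms(2))
  have "orth_proj ?W x = (1/2) *\<^sub>R (x - R *v x)" for x
  proof (rule orth_proj_eqI)
    show "subspace ?W"
      by (auto simp: subspace_def matrix_vector_right_distrib matrix_vector_mult_scaleR)
    show "(1/2) *\<^sub>R (x - R *v x) \<in> ?W"
      by (simp add: matrix_vector_mult_scaleR matrix_vector_mult_diff_distrib RR algebra_simps)
    fix w assume "w \<in> ?W"
    then have w: "(R *v x) \<bullet> w = - (x \<bullet> w)" by (simp add: symmetric_inner[OF sym])
    have "x - (1/2) *\<^sub>R (x - R *v x) = (1/2) *\<^sub>R (x + R *v x)"
      by (simp add: vec_eq_iff field_simps)
    then show "orthogonal (x - (1/2) *\<^sub>R (x - R *v x)) w"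
      using w by (simp add: orthogonal_def inner_add_left)
  qed
  then have "orth_proj ?W = (*v) ((1/2) *\<^sub>R (mat 1 - R))"
    by (auto simp: matrix_vector_mult_diff_rdistrib simp flip: scaleR_matrix_vector_assoc)
  then show ?thesis by (simp add: Phi_def)
qed

theorem bij_betw_Phi:
  assumes "even CARD('m::finite)"
  shows "bij_betw Phi (Gr CARD('m) :: (real^'p) set set) (Inv_SO CARD('m))"
proof (rule bij_betwI[where g = "\<lambda>R. {x. R *v x = - x}"])
  show "Phi \<in> (Gr CARD('m) :: (real^'p) set set) \<rightarrow> Inv_SO CARD('m)"
  proof
    fix W :: "(real^'p) set" assume W: "W \<in> Gr CARD('m)"
    obtain A :: "real^'m^'p" where A: "orthonormal_basis_of A W"
      using ex_orthonormal_basis_of[OF W] by blast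
    then have AA: "transpose A ** A = mat 1" by (simp add: orthonormal_basis_of_iff)
    have dim: "dim {x. Phi W *v x = - x} = CARD('m)"
      using W by (simp add: Phi_eigenspace[OF W] Gr_def)
    moreover have "Phi W \<noteq> mat 1"
    proof
      assume "Phi W = mat 1"
      moreover have "{x. x = - x} = {0 :: real^'p}" by (auto simp: eq_neg_iff_add_eq_0 simp flip: scaleR_2)
      ultimately show False using dim by simp
    qed
    ultimately show "Phi W \<in> Inv_SO CARD('m)"
      using frame_involution_SO[OF assms AA] frame_involution_square[OF AA]
      by (simp add: Inv_SO_def Phi_orthonormal_basis[OF A])
  qed
  show "(\<lambda>R. {x. R *v x = - x}) \<in> Inv_SO CARD('m) \<rightarrow> (Gr CARD('m) :: (real^'p) set set)"
    by (auto simp: Inv_SO_def Gr_def subspace_def matrix_vector_right_distrib matrix_vector_mult_scaleR)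
  show "{x. Phi W *v x = - x} = W" if "W \<in> Gr CARD('m)" for W :: "(real^'p) set"
    by (rule Phi_eigenspace[OF that])
  show "Phi {x. R *v x = - x} = R" if "R \<in> Inv_SO CARD('m)" for R :: "real^'p^'p"
    using that by (intro Phi_eigenspace_of_involution) (auto simp: Inv_SO_def SO_orthogonal)
qed

section \<open>Singular values and principal vectors\<close>

lemma orthonormal_family_expansion:
  fixes e :: "'n::finite \<Rightarrow> real^'n"
  assumes "orthonormal_family UNIV e"
  shows "x = (\<Sum>i\<in>UNIV. (e i \<bullet> x) *\<^sub>R e i)"
proof -
  define A where "A = mat_of_cols e"
  have "transpose A ** A = mat 1"
    using assms by (simp add: A_def flip: orthonormal_family_iff_gram)
  then have "A ** transpose A = mat 1"
    using matrix_left_right_inverse by blast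
  then have "x = A *v (transpose A *v x)" by (simp only: matrix_vector_mul_assoc matrix_vector_mul_lid)
  also have "\<dots> = (\<Sum>i\<in>UNIV. (transpose A *v x) $ i *\<^sub>R column i A)"
    by (simp only: matrix_mult_sum scalar_mult_eq_scaleR)
  also have "\<dots> = (\<Sum>i\<in>UNIV. (e i \<bullet> x) *\<^sub>R e i)"
    by (simp only: matrix_vector_mul_component)
      (simp add: A_def mat_of_cols_def transpose_def column_def vec_nth_inverse)
  finally show ?thesis .
qed

lemma dim_eigenspace_orthonormal:
  fixes S :: "real^'n^'n"
  assumes e: "orthonormal_family (UNIV :: 'n set) e" and d: "\<And>i. S *v e i = d i *\<^sub>R e i"
  shows "dim {x. S *v x = c *\<^sub>R x} = card {i. d i = c}"
proof -
  have ee: "e i \<bullet> e j = (if i = j then 1 else 0)" for i j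
    using e by (auto simp: orthonormal_family_def)
  then have inj: "inj e" by (metis injI zero_neq_one)
  let ?B = "e ` {i. d i = c}"
  have "{x. S *v x = c *\<^sub>R x} = span ?B"
  proof (intro subset_antisym subsetI)
    fix x assume "x \<in> {x. S *v x = c *\<^sub>R x}"
    then have x: "S *v x = c *\<^sub>R x" by simp
    have coord: "e i \<bullet> x = 0" if "d i \<noteq> c" for i
    proof -
      have ex: "x = (\<Sum>i\<in>UNIV. (e i \<bullet> x) *\<^sub>R e i)" by (rule orthonormal_family_expansion[OF e])
      then have "S *v x = S *v (\<Sum>i\<in>UNIV. (e i \<bullet> x) *\<^sub>R e i)" by (rule arg_cong)
      also have "\<dots> = (\<Sum>i\<in>UNIV. (e i \<bullet> x) *\<^sub>R (d i *\<^sub>R e i))"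
        by (simp add: linear_sum[OF matrix_vector_mul_linear] matrix_vector_mult_scaleR d)
      finally have "e i \<bullet> (S *v x) = (\<Sum>j\<in>UNIV. (e j \<bullet> x) * d j * (e i \<bullet> e j))"
        by (simp add: inner_sum_right mult.assoc)
      also have "\<dots> = (e i \<bullet> x) * d i"
        by (simp add: ee if_distrib[of "(*) _"] cong: if_cong)
      finally show ?thesis using x that by simp
    qed
    have "(\<Sum>i\<in>UNIV. (e i \<bullet> x) *\<^sub>R e i) \<in> span ?B"
    proof (rule span_sum)
      fix i show "(e i \<bullet> x) *\<^sub>R e i \<in> span ?B"
        by (cases "d i = c") (auto simp: coord span_zero intro: span_scale span_base)
    qed
    then show "x \<in> span ?B" using orthonormal_family_expansion[OF e, of x] by simp
  next
    fix x assume "x \<in> span ?B"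
    moreover have "span ?B \<subseteq> {x. S *v x = c *\<^sub>R x}"
      by (rule span_minimal)
        (auto simp: d subspace_def matrix_vector_right_distrib matrix_vector_mult_scaleR scaleR_add_right)
    ultimately show "x \<in> {x. S *v x = c *\<^sub>R x}" by blast
  qed
  moreover have "independent ?B"
  proof (rule pairwise_orthogonal_independent)
    show "pairwise orthogonal ?B" by (auto simp: pairwise_def orthogonal_def ee)
    show "0 \<notin> ?B" using ee by (metis (no_types, lifting) image_iff inner_zero_left zero_neq_one)
  qed
  ultimately show ?thesis
    by (simp add: dim_eq_card_independent card_image[OF inj_on_subset[OF inj]])
qed

text \<open>The images under \<open>M\<close> of an orthonormal eigenbasis of \<open>M\<^sup>T M\<close> are orthogonal. Normalising them
  gives the left singular vectors with nonzero singular value; the others are an arbitrary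
  completion, because there \<open>M\<close> vanishes.\<close>

theorem singular_value_decomposition:
  fixes M :: "real^'m^'m"
  obtains f g s where "orthonormal_family (UNIV :: 'm set) f" "orthonormal_family (UNIV :: 'm set) g"
    and "\<And>i. M *v g i = s i *\<^sub>R f i" "is_singular_values M s"
proof -
  let ?S = "transpose M ** M"
  have sym: "transpose ?S = ?S" by (simp add: matrix_transpose_mul)
  obtain g d where g: "orthonormal_family (UNIV :: 'm set) g" and d: "\<And>i. ?S *v g i = d i *\<^sub>R g i"
    using symmetric_matrix_eigenbasis[OF sym] by blast
  have gg: "g i \<bullet> g j = (if i = j then 1 else 0)" for i j
    using g by (auto simp: orthonormal_family_def)
  have MM: "(M *v g i) \<bullet> (M *v g j) = (if i = j then d i else 0)" for i j
  proof -
    have "(M *v g i) \<bullet> (M *v g j) = (transpose M *v (M *v g i)) \<bullet> g j"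
      by (rule transpose_inner[symmetric])
    also have "\<dots> = (if i = j then d i else 0)"
      by (simp only: matrix_vector_mul_assoc d inner_scaleR_left gg) simp
    finally show ?thesis .
  qed
  have d0: "0 \<le> d i" for i using MM[of i i] by (metis inner_ge_zero)
  define s where "s i = sqrt (d i)" for i
  have s: "0 \<le> s i" "s i * s i = d i" for i using d0 by (auto simp: s_def)
  define J where "J = {i. s i \<noteq> 0}"
  have "orthonormal_family J (\<lambda>i. (M *v g i) /\<^sub>R s i)"
    using s by (auto simp: orthonormal_family_def J_def MM divide_simps)
  then obtain f where f: "orthonormal_family UNIV f" "\<And>i. i \<in> J \<Longrightarrow> f i = (M *v g i) /\<^sub>R s i"
    using orthonormal_family_extend by blast
  have "M *v g i = s i *\<^sub>R f i" for i
  proof (cases "i \<in> J")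
    case True
    then show ?thesis using f(2)[OF True] by (simp add: J_def)
  next
    case False
    then have "(M *v g i) \<bullet> (M *v g i) = 0" using s(2)[of i] by (simp add: MM J_def)
    then show ?thesis using False by (simp add: J_def)
  qed
  moreover have "is_singular_values M s"
    unfolding is_singular_values_def
  proof (intro conjI allI impI)
    fix c :: real assume "0 \<le> c"
    then have "{i. s i = c} = {i. d i = c\<^sup>2}"
      using s by (auto simp: power2_eq_square s_def real_sqrt_unique)
    then show "card {i. s i = c} = dim {x. ?S *v x = c\<^sup>2 *\<^sub>R x}"
      using dim_eigenspace_orthonormal[OF g d] by simp
  qed (rule s)
  ultimately show thesis using that f(1) g by blast
qed

text \<open>The singular values are determined only up to their order, so quantities depending on a choice
  of them are compared through symmetric functions.\<close>

lemma is_singular_values_sum_unique: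
  assumes "is_singular_values M s" "is_singular_values M s'"
  shows "(\<Sum>i\<in>UNIV. h (s i)) = (\<Sum>i\<in>UNIV. h (s' i) :: real)"
proof -
  have group: "(\<Sum>i\<in>UNIV. h (r i)) = (\<Sum>c\<in>range s \<union> range s'. real (card {i. r i = c}) * h c)"
    if "range r \<subseteq> range s \<union> range s'" for r :: "'a \<Rightarrow> real"
  proof -
    have "(\<Sum>i\<in>UNIV. h (r i)) = (\<Sum>c\<in>range s \<union> range s'. \<Sum>i | i \<in> UNIV \<and> r i = c. h (r i))"
      by (rule sum.group[symmetric]) (use that in auto)
    also have "\<dots> = (\<Sum>c\<in>range s \<union> range s'. real (card {i. r i = c}) * h c)"
      by (intro sum.cong) auto
    finally show ?thesis .
  qed
  have "card {i. s i = c} = card {i. s' i = c}" if "c \<in> range s \<union> range s'" for c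
  proof -
    have "0 \<le> c" using assms that by (auto simp: is_singular_values_def)
    then show ?thesis using assms by (simp add: is_singular_values_def)
  qed
  then show ?thesis by (simp add: group)
qed

definition diag :: "('m \<Rightarrow> real) \<Rightarrow> real^'m^'m" where
  "diag c = (\<chi> i j. if i = j then c i else 0)"

lemma diag_mult: "diag c ** diag d = diag (\<lambda>i. c i * d i)"
  by (simp add: diag_def matrix_matrix_mult_def vec_eq_iff mult_delta_left mult_delta_right)

lemma diag_const_1: "diag (\<lambda>i. 1) = mat 1"
  by (simp add: diag_def mat_def vec_eq_iff)

lemma diag_add: "diag c + diag d = diag (\<lambda>i. c i + d i)"
  by (simp add: diag_def vec_eq_iff)

lemma diag_diff: "diag c - diag d = diag (\<lambda>i. c i - d i)"
  by (simp add: diag_def vec_eq_iff)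

lemma transpose_diag: "transpose (diag c) = diag c"
  by (auto simp: diag_def transpose_def vec_eq_iff)

lemma mpow_diag: "mpow (diag c) n = diag (\<lambda>i. c i ^ n)"
  by (induction n) (simp_all add: diag_mult diag_const_1)

lemma trace_diag: "trace (diag c) = (\<Sum>i\<in>UNIV. c i)"
  by (simp add: trace_def diag_def)

lemma column_mult_diag: "column j (X ** diag c) = c j *\<^sub>R column j X" for X :: "real^'m^'n"
  by (simp add: column_def diag_def matrix_matrix_mult_def vec_eq_iff mult_delta_right)

text \<open>The singular value decomposition of the Gram matrix of any two orthonormal bases provides rotations
  of these bases after which the Gram matrix is diagonal. Rotating a basis inside its subspace
  leaves the projection unchanged.\<close>

lemma ex_principal_frames:
  fixes W V :: "(real^'p) set"
  assumes W: "W \<in> Gr CARD('m::finite)" and V: "V \<in> Gr CARD('m)"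
  obtains A B :: "real^'m^'p" and \<phi> where
    "transpose A ** A = mat 1" "transpose B ** B = mat 1"
    "Phi W = frame_involution A" "Phi V = frame_involution B"
    "transpose A ** B = diag (\<lambda>i. cos (\<phi> i))"
    "\<And>i. 0 \<le> \<phi> i" "\<And>i. \<phi> i \<le> pi / 2"
    "d_Gr TYPE('m) W V = sqrt (\<Sum>i\<in>UNIV. (\<phi> i)\<^sup>2)"
proof -
  define A0 :: "real^'m^'p" where "A0 = (SOME A. orthonormal_basis_of A W)"
  define B0 :: "real^'m^'p" where "B0 = (SOME B. orthonormal_basis_of B V)"
  have A0: "orthonormal_basis_of A0 W"
    unfolding A0_def by (rule someI_ex[OF ex_orthonormal_basis_of[OF W]])
  have B0: "orthonormal_basis_of B0 V"
    unfolding B0_def by (rule someI_ex[OF ex_orthonormal_basis_of[OF V]])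
  define M where "M = transpose A0 ** B0"
  obtain f g s where f: "orthonormal_family (UNIV :: 'm set) f" and g: "orthonormal_family (UNIV :: 'm set) g"
    and M: "\<And>i. M *v g i = s i *\<^sub>R f i" and s: "is_singular_values M s"
    using singular_value_decomposition by blast
  define F where "F = mat_of_cols f"
  define G where "G = mat_of_cols g"
  have FG: "transpose F ** F = mat 1" "transpose G ** G = mat 1"
    using f g by (simp_all add: F_def G_def flip: orthonormal_family_iff_gram)
  then have FG': "F ** transpose F = mat 1" "G ** transpose G = mat 1"
    using matrix_left_right_inverse by blast+
  define A where "A = A0 ** F"
  define B where "B = B0 ** G"
  have frame: "transpose (A0 ** F) ** (A0 ** F) = mat 1 \<and> frame_involution (A0 ** F) = frame_involution A0"
    if "transpose A0 ** A0 = mat 1" "transpose F ** F = mat 1" "F ** transpose F = mat 1"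
    for A0 :: "real^'m^'p" and F :: "real^'m^'m"
  proof
    have "transpose (A0 ** F) ** (A0 ** F) = transpose F ** (transpose A0 ** A0) ** F"
      by (simp only: matrix_transpose_mul matrix_mul_assoc)
    then show "transpose (A0 ** F) ** (A0 ** F) = mat 1" by (simp add: that)
    have "(A0 ** F) ** transpose (A0 ** F) = A0 ** (F ** transpose F) ** transpose A0"
      by (simp only: matrix_transpose_mul matrix_mul_assoc)
    then show "frame_involution (A0 ** F) = frame_involution A0"
      by (simp add: that frame_involution_def)
  qed
  have MG: "M ** G = F ** diag s"
  proof -
    have "column j (M ** G) = column j (F ** diag s)" for j
      by (simp add: column_matrix_mult[of j M] column_mult_diag F_def G_def M)
    then show ?thesis by (simp add: column_def vec_eq_iff)
  qed
  have "transpose A ** B = transpose F ** (M ** G)"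
    by (simp only: A_def B_def M_def matrix_transpose_mul matrix_mul_assoc)
  also have "\<dots> = diag s" by (simp only: MG matrix_mul_assoc FG matrix_mul_lid)
  finally have AB: "transpose A ** B = diag s" .
  have A: "transpose A ** A = mat 1" "frame_involution A = Phi W"
    and B: "transpose B ** B = mat 1" "frame_involution B = Phi V"
    using frame[of A0 F] frame[of B0 G] FG FG' A0 B0
    by (auto simp: A_def B_def orthonormal_basis_of_iff Phi_orthonormal_basis[OF A0] Phi_orthonormal_basis[OF B0])
  have s0: "0 \<le> s i" for i using s by (simp add: is_singular_values_def)
  have s1: "s i \<le> 1" for i
  proof -
    have "s i = (transpose A ** B) $ i $ i" by (simp add: AB diag_def)
    also have "\<dots> \<le> norm (column i A) * norm (column i B)"
      unfolding gram_component by (rule norm_cauchy_schwarz)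
    also have "\<dots> = 1"
      using A(1) B(1) by (simp add: norm_eq_sqrt_inner orthonormal_family_def flip: orthonormal_family_iff_gram)
    finally show ?thesis .
  qed
  define \<phi> where "\<phi> i = arccos (s i)" for i
  have "principal_angle W V i = arccos (singular_value M i)" for i :: 'm
    by (simp add: principal_angle_def A0_def B0_def M_def Let_def)
  moreover have "is_singular_values M (singular_value M)"
    using someI[of "is_singular_values M" s] s by (simp add: singular_value_def)
  ultimately have "(\<Sum>i\<in>(UNIV :: 'm set). (principal_angle W V i)\<^sup>2) = (\<Sum>i\<in>UNIV. (\<phi> i)\<^sup>2)"
    using is_singular_values_sum_unique[of M "singular_value M" s "\<lambda>c. (arccos c)\<^sup>2"] s
    by (simp add: \<phi>_def)
  then have "d_Gr TYPE('m) W V = sqrt (\<Sum>i\<in>UNIV. (\<phi> i)\<^sup>2)" by (simp add: d_Gr_def)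
  moreover have "cos (\<phi> i) = s i" "0 \<le> \<phi> i" "\<phi> i \<le> pi / 2" for i
    unfolding \<phi>_def using s0[of i] s1[of i] arccos_le_pi2[OF s0 s1]
    by (auto intro!: cos_arccos arccos_lbound)
  ultimately show thesis using that[of A B \<phi>] A B AB by simp
qed

section \<open>The relative position of two involutions\<close>

lemma cos_defect_frame_involutions:
  fixes A B :: "real^'m^'p"
  assumes A: "transpose A ** A = mat 1" and B: "transpose B ** B = mat 1"
  defines "D \<equiv> A ** transpose A - B ** transpose B"
  shows "cos_defect (frame_involution A ** frame_involution B) = 2 *\<^sub>R (D ** D)"
proof -
  define P where "P = A ** transpose A"
  define R where "R = B ** transpose B"
  have PR: "P ** P = P" "R ** R = R" "transpose P = P" "transpose R = R"
    by (simp_all add: P_def R_def frame_projection_idem A B matrix_transpose_mul)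
  have "cos_defect ((mat 1 - 2 *\<^sub>R P) ** (mat 1 - 2 *\<^sub>R R)) = 2 *\<^sub>R ((P - R) ** (P - R))"
    by (simp add: cos_defect_def matrix_transpose_mul transpose_linear PR matrix_mult_bilinear
        vec_eq_iff field_simps)
  then show ?thesis by (simp add: frame_involution_def D_def P_def R_def)
qed

text \<open>With \<open>D = P - R\<close> the difference of the two projections, \<open>D\<^sup>2\<close> acts on each of the two
  subspaces as \<open>sin\<^sup>2\<close> of the principal angles. That these two contributions exhaust the trace is
  due to \<open>1 - P - R\<close> anticommuting with \<open>D\<close>.\<close>

lemma trace_mpow_cos_defect_frames:
  fixes A B :: "real^'m^'p"
  assumes A: "transpose A ** A = mat 1" and B: "transpose B ** B = mat 1"
    and AB: "transpose A ** B = diag c" and n: "0 < n"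
  shows "trace (mpow (cos_defect (frame_involution A ** frame_involution B)) n)
    = 2 * (\<Sum>i\<in>UNIV. (2 * (1 - (c i)\<^sup>2)) ^ n)"
proof -
  define P where "P = A ** transpose A"
  define R where "R = B ** transpose B"
  define D where "D = P - R"
  define E where "E = D ** D"
  define C where "C = mat 1 - P - R"
  have PR: "P ** P = P" "R ** R = R"
    by (simp_all add: P_def R_def frame_projection_idem A B)
  have BA: "transpose B ** A = diag c"
    using arg_cong[OF AB, of transpose] by (simp add: matrix_transpose_mul transpose_diag)
  have anti: "D ** C = - (C ** D)"
    by (simp add: D_def C_def matrix_mult_bilinear PR)
  have "trace (mpow E n ** C) = 0"
  proof -
    obtain k where k: "n = Suc k" using n by (cases n) auto
    have comm: "D ** mpow E k = mpow E k ** D"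
      by (rule mpow_intertwine) (simp add: E_def matrix_mul_assoc)
    have En: "mpow E n = mpow E k ** D ** D"
      by (simp only: k mpow_Suc_right) (simp only: E_def matrix_mul_assoc)
    then have "mpow E n ** C = (mpow E k ** D) ** (D ** C)"
      by (simp only: matrix_mul_assoc)
    then have "trace (mpow E n ** C) = - trace ((mpow E k ** D ** C) ** D)"
      by (simp add: anti matrix_mult_bilinear trace_minus matrix_mul_assoc)
    also have "trace ((mpow E k ** D ** C) ** D) = trace (D ** (mpow E k ** D ** C))"
      by (rule trace_mul_sym)
    also have "D ** (mpow E k ** D ** C) = (D ** mpow E k) ** D ** C"
      by (simp only: matrix_mul_assoc)
    also have "\<dots> = mpow E n ** C"
      by (simp only: comm En)
    finally show ?thesis by simp
  qed
  then have split: "trace (mpow E n) = trace (mpow E n ** P) + trace (mpow E n ** R)"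
    by (simp add: C_def matrix_mult_bilinear trace_sub)
  have part: "trace (mpow E n ** (X ** transpose X)) = (\<Sum>i\<in>UNIV. (1 - (c i)\<^sup>2) ^ n)"
    if X: "transpose X ** X = mat 1"
      and XE: "transpose X ** E = diag (\<lambda>i. 1 - (c i)\<^sup>2) ** transpose X" for X :: "real^'m^'p"
  proof -
    have "trace (mpow E n ** (X ** transpose X)) = trace ((mpow E n ** X) ** transpose X)"
      by (simp only: matrix_mul_assoc)
    also have "\<dots> = trace (transpose X ** (mpow E n ** X))" by (rule trace_mul_sym)
    also have "transpose X ** (mpow E n ** X) = (transpose X ** mpow E n) ** X"
      by (simp only: matrix_mul_assoc)
    also have "\<dots> = diag (\<lambda>i. (1 - (c i)\<^sup>2) ^ n)"
      by (simp add: mpow_intertwine[OF XE] mpow_diag X flip: matrix_mul_assoc)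
    finally show ?thesis by (simp add: trace_diag)
  qed
  have diag1: "mat 1 - diag c ** diag c = diag (\<lambda>i. 1 - (c i)\<^sup>2)"
    by (simp add: diag_mult diag_diff power2_eq_square flip: diag_const_1)
  have AE: "transpose A ** E = diag (\<lambda>i. 1 - (c i)\<^sup>2) ** transpose A"
  proof -
    have 1: "transpose A ** P = transpose A" "transpose A ** R = diag c ** transpose B"
      by (simp_all add: P_def R_def matrix_mul_assoc A AB)
    have 2: "diag c ** transpose B ** P = diag c ** diag c ** transpose A"
      "diag c ** transpose B ** R = diag c ** transpose B"
      by (simp_all add: P_def R_def BA matrix_mul_assoc) (simp_all add: BA B flip: matrix_mul_assoc)
    show ?thesis
      by (simp add: E_def D_def matrix_mult_bilinear matrix_mul_assoc 1 2 flip: diag1)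
  qed
  have BE: "transpose B ** E = diag (\<lambda>i. 1 - (c i)\<^sup>2) ** transpose B"
  proof -
    have 1: "transpose B ** P = diag c ** transpose A" "transpose B ** R = transpose B"
      by (simp_all add: P_def R_def matrix_mul_assoc B BA)
    have 2: "diag c ** transpose A ** R = diag c ** diag c ** transpose B"
      "diag c ** transpose A ** P = diag c ** transpose A"
      by (simp_all add: P_def R_def AB matrix_mul_assoc) (simp_all add: AB A flip: matrix_mul_assoc)
    show ?thesis
      by (simp add: E_def D_def matrix_mult_bilinear matrix_mul_assoc 1 2 flip: diag1)
  qed
  have "trace (mpow E n) = 2 * (\<Sum>i\<in>UNIV. (1 - (c i)\<^sup>2) ^ n)"
    using split part[OF A AE] part[OF B BE] by (simp add: P_def R_def)
  moreover have "cos_defect (frame_involution A ** frame_involution B) = 2 *\<^sub>R E"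
    using cos_defect_frame_involutions[OF A B] by (simp add: E_def D_def P_def R_def)
  ultimately show ?thesis
    by (simp only: mpow_scaleR trace_scaleR power_mult_distrib sum_distrib_left[symmetric] mult.left_commute)
qed

lemma trace_arcsq_mat_frames:
  fixes A B :: "real^'m^'p"
  assumes "transpose A ** A = mat 1" "transpose B ** B = mat 1"
    and "transpose A ** B = diag (\<lambda>i. cos (\<phi> i))"
  shows "trace (arcsq_mat N (cos_defect (frame_involution A ** frame_involution B)))
    = 2 * (\<Sum>i\<in>UNIV. arcsq N (1 - cos (2 * \<phi> i)))"
proof -
  have sq: "2 * (1 - (cos (\<phi> i))\<^sup>2) = 1 - cos (2 * \<phi> i)" for i
    by (simp add: cos_double_cos)
  have "trace (mpow (cos_defect (frame_involution A ** frame_involution B)) n)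
      = 2 * (\<Sum>i\<in>UNIV. (1 - cos (2 * \<phi> i)) ^ n)" if "0 < n" for n
    unfolding trace_mpow_cos_defect_frames[OF assms that] sq ..
  then have eq: "arcsq_coeff n * trace (mpow (cos_defect (frame_involution A ** frame_involution B)) n)
      = 2 * (\<Sum>i\<in>UNIV. arcsq_coeff n * (1 - cos (2 * \<phi> i)) ^ n)" for n
    by (cases "n = 0") (simp_all flip: sum_distrib_left)
  then show ?thesis
    unfolding trace_arcsq_mat arcsq_def eq by (subst sum.swap) (simp only: sum_distrib_left)
qed

text \<open>Each principal angle \<open>\<phi>\<close> produces a plane in which the product of the two involutions rotates by
  \<open>2 \<phi>\<close>. Letting \<open>N\<close> tend to infinity in the bound for the truncated series yields the
  squares of these angles.\<close>

theorem SO_length_ge_principal_angles: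
  fixes A B :: "real^'m^'p"
  assumes A: "transpose A ** A = mat 1" and B: "transpose B ** B = mat 1"
    and AB: "transpose A ** B = diag (\<lambda>i. cos (\<phi> i))"
    and \<phi>: "\<And>i. 0 \<le> \<phi> i" "\<And>i. \<phi> i \<le> pi / 2"
    and path: "SO_path \<gamma> (frame_involution A) (frame_involution B)"
  shows "2 * sqrt (\<Sum>i\<in>UNIV. (\<phi> i)\<^sup>2) \<le> SO_length \<gamma>"
proof -
  have le: "(\<Sum>i\<in>UNIV. arcsq N (1 - cos (2 * \<phi> i))) \<le> (SO_length \<gamma>)\<^sup>2" for N
    using SO_length_ge[OF path, of N]
    by (simp add: transpose_frame_involution trace_arcsq_mat_frames[OF A B AB])
  have "(\<Sum>i\<in>UNIV. (2 * \<phi> i)\<^sup>2) \<le> (SO_length \<gamma>)\<^sup>2"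
  proof (rule field_le_epsilon)
    fix \<epsilon> :: real assume "0 < \<epsilon>"
    define \<delta> where "\<delta> = \<epsilon> / real CARD('m)"
    have \<delta>: "0 < \<delta>" using \<open>0 < \<epsilon>\<close> by (simp add: \<delta>_def)
    have "\<forall>\<^sub>F N in sequentially. \<forall>i. (2 * \<phi> i)\<^sup>2 - \<delta> \<le> arcsq N (1 - cos (2 * \<phi> i))"
    proof (rule eventually_all_finite)
      show "\<forall>\<^sub>F N in sequentially. (2 * \<phi> i)\<^sup>2 - \<delta> \<le> arcsq N (1 - cos (2 * \<phi> i))" for i
        using \<phi>[of i] \<delta> by (intro arcsq_eventually_ge) auto
    qed
    then obtain N where N: "\<And>i. (2 * \<phi> i)\<^sup>2 - \<delta> \<le> arcsq N (1 - cos (2 * \<phi> i))"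
      using eventually_happens'[OF sequentially_bot] by blast
    have "(\<Sum>i\<in>UNIV. (2 * \<phi> i)\<^sup>2) - \<epsilon> = (\<Sum>i\<in>UNIV. (2 * \<phi> i)\<^sup>2 - \<delta>)"
      by (simp add: sum_subtractf \<delta>_def)
    also have "\<dots> \<le> (\<Sum>i\<in>UNIV. arcsq N (1 - cos (2 * \<phi> i)))" by (intro sum_mono N)
    also note le
    finally show "(\<Sum>i\<in>UNIV. (2 * \<phi> i)\<^sup>2) \<le> (SO_length \<gamma>)\<^sup>2 + \<epsilon>" by simp
  qed
  moreover have "0 \<le> SO_length \<gamma>"
    by (rule SO_pathE[OF path]) (simp add: integral_nonneg integrable_continuous_interval continuous_on_norm)
  ultimately have "sqrt (\<Sum>i\<in>UNIV. (2 * \<phi> i)\<^sup>2) \<le> SO_length \<gamma>" by (rule real_le_lsqrt[rotated])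
  then show ?thesis
    by (simp add: power_mult_distrib real_sqrt_mult flip: sum_distrib_left)
qed

section \<open>The geodesic between two involutions\<close>

lemma diag_has_vector_derivative:
  fixes f :: "'m::finite \<Rightarrow> real \<Rightarrow> real"
  assumes "\<And>i. (f i has_real_derivative g i) (at t within S)"
  shows "((\<lambda>t. diag (\<lambda>i. f i t)) has_vector_derivative diag g) (at t within S)"
proof -
  have diag: "diag c = (\<Sum>i\<in>UNIV. c i *\<^sub>R diag (\<lambda>j. if j = i then 1 else 0))" for c :: "'m \<Rightarrow> real"
    by (simp add: diag_def vec_eq_iff mult_delta_right)
  have "((\<lambda>t. \<Sum>i\<in>UNIV. f i t *\<^sub>R diag (\<lambda>j. if j = i then 1 else 0)) has_vector_derivative
      (\<Sum>i\<in>UNIV. g i *\<^sub>R diag (\<lambda>j. if j = i then 1 else 0))) (at t within S)"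
    by (intro has_vector_derivative_sum
        bounded_linear.has_vector_derivative[OF bounded_linear_scaleR_left])
      (use assms in \<open>simp add: has_real_derivative_iff_has_vector_derivative\<close>)
  then show ?thesis by (simp only: diag[symmetric])
qed

lemma continuous_on_diag:
  assumes "\<And>i. continuous_on S (f i)"
  shows "continuous_on S (\<lambda>t. diag (\<lambda>i. f i t))"
proof -
  have "continuous_on S (\<lambda>t. if i = j then f i t else 0)" for i j
    using assms by (cases "i = j") auto
  then show ?thesis unfolding diag_def by (intro continuous_on_vec_lambda)
qed

text \<open>A path of frames that moves orthogonally to the subspaces it spans has no component that
  merely rotates the frame; the factor 2 of the isometry appears here.\<close>

lemma norm_frame_involution_velocity:
  fixes A G :: "real^'m^'p"
  assumes A: "transpose A ** A = mat 1" and AG: "transpose A ** G = 0"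
  shows "norm (- (2 *\<^sub>R (A ** transpose G + G ** transpose A))) = 2 * sqrt 2 * norm G"
proof -
  let ?X = "A ** transpose G + G ** transpose A"
  have GA: "transpose G ** A = 0"
    using arg_cong[OF AG, of transpose] by (simp add: matrix_transpose_mul transpose_linear)
  have "transpose ?X ** ?X = A ** (transpose G ** A) ** transpose G + A ** (transpose G ** G) ** transpose A
      + G ** (transpose A ** A) ** transpose G + G ** (transpose A ** G) ** transpose A"
    by (simp add: transpose_linear matrix_transpose_mul matrix_mult_bilinear matrix_mul_assoc)
  then have "transpose ?X ** ?X = (A ** (transpose G ** G)) ** transpose A + G ** transpose G"
    by (simp add: A AG GA matrix_mult_bilinear)
  moreover have "trace ((A ** (transpose G ** G)) ** transpose A) = trace (transpose G ** G)"
    by (subst trace_mul_sym) (simp add: matrix_mul_assoc A)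
  moreover have "trace (G ** transpose G) = trace (transpose G ** G)" by (rule trace_mul_sym)
  ultimately have "?X \<bullet> ?X = 2 * (G \<bullet> G)"
    by (simp add: inner_matrix_eq_trace trace_add)
  then have "norm ?X = sqrt 2 * norm G"
    by (simp add: norm_eq_sqrt_inner real_sqrt_mult)
  then show ?thesis by simp
qed

text \<open>Every principal vector of the first subspace rotates with constant speed \<open>\<phi> i\<close> towards its partner
  in the second one. The columns of \<open>U\<close> are the unit vectors orthogonal to the first subspace
  that point in the directions of motion.\<close>

theorem ex_SO_path_principal_angles:
  fixes A B :: "real^'m^'p"
  assumes even: "even CARD('m)"
    and A: "transpose A ** A = mat 1" and B: "transpose B ** B = mat 1"
    and AB: "transpose A ** B = diag (\<lambda>i. cos (\<phi> i))"
    and \<phi>: "\<And>i. 0 \<le> \<phi> i" "\<And>i. \<phi> i \<le> pi / 2"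
  shows "\<exists>\<gamma>. SO_path \<gamma> (frame_involution A) (frame_involution B) \<and>
    SO_length \<gamma> = 2 * sqrt (\<Sum>i\<in>UNIV. (\<phi> i)\<^sup>2)"
proof -
  define Z where "Z = B - A ** diag (\<lambda>i. cos (\<phi> i))"
  \<comment> \<open>Where \<open>\<phi> i = 0\<close>, the two principal vectors agree and \<open>1 / sin (\<phi> i) = 0\<close> makes the
    direction of motion vanish.\<close>
  define U where "U = Z ** diag (\<lambda>i. 1 / sin (\<phi> i))"
  have sin0: "sin (\<phi> i) = 0 \<longleftrightarrow> \<phi> i = 0" for i
    using sin_gt_zero[of "\<phi> i"] \<phi>[of i] by (cases "\<phi> i = 0") auto
  have BA: "transpose B ** A = diag (\<lambda>i. cos (\<phi> i))"
    using arg_cong[OF AB, of transpose] by (simp add: matrix_transpose_mul transpose_diag)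
  have AZ: "transpose A ** Z = 0"
    by (simp add: Z_def matrix_mult_bilinear matrix_mul_assoc A AB)
  have ZZ: "transpose Z ** Z = diag (\<lambda>i. (sin (\<phi> i))\<^sup>2)"
  proof -
    have "transpose Z ** Z = transpose B ** Z"
      by (simp add: Z_def[THEN arg_cong[of _ _ transpose]] transpose_linear matrix_transpose_mul
          matrix_mult_bilinear AZ flip: matrix_mul_assoc)
    also have "\<dots> = mat 1 - diag (\<lambda>i. cos (\<phi> i)) ** diag (\<lambda>i. cos (\<phi> i))"
      by (simp add: Z_def matrix_mult_bilinear matrix_mul_assoc B BA)
    also have "\<dots> = diag (\<lambda>i. (sin (\<phi> i))\<^sup>2)"
      by (simp add: diag_mult diag_diff sin_squared_eq flip: diag_const_1) (simp add: power2_eq_square)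
    finally show ?thesis .
  qed
  have AU: "transpose A ** U = 0"
    by (simp add: U_def matrix_mul_assoc AZ matrix_mult_bilinear)
  have UA: "transpose U ** A = 0"
    using arg_cong[OF AU, of transpose] by (simp add: matrix_transpose_mul transpose_linear)
  define \<nu> where "\<nu> i = (if \<phi> i = 0 then 0 else 1 :: real)" for i
  have UU: "transpose U ** U = diag \<nu>"
  proof -
    have "transpose U ** U = diag (\<lambda>i. 1 / sin (\<phi> i)) ** (transpose Z ** Z) ** diag (\<lambda>i. 1 / sin (\<phi> i))"
      by (simp only: U_def matrix_transpose_mul transpose_diag matrix_mul_assoc)
    also have "\<dots> = diag \<nu>"
      unfolding ZZ diag_mult by (rule arg_cong[of _ _ diag]) (auto simp: \<nu>_def sin0 power2_eq_square)
    finally show ?thesis .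
  qed
  have ZU: "Z = U ** diag (\<lambda>i. sin (\<phi> i))"
  proof -
    have "column j Z = column j (U ** diag (\<lambda>i. sin (\<phi> i)))" for j
    proof (cases "\<phi> j = 0")
      case True
      have "column j Z \<bullet> column j Z = 0"
        using True by (simp add: ZZ diag_def flip: gram_component)
      then show ?thesis using True by (simp add: column_mult_diag)
    next
      case False
      then show ?thesis by (simp add: U_def column_mult_diag sin0)
    qed
    then show ?thesis by (simp add: column_def vec_eq_iff)
  qed
  define F where "F t = A ** diag (\<lambda>i. cos (t * \<phi> i)) + U ** diag (\<lambda>i. sin (t * \<phi> i))" for t
  define G where "G t = A ** diag (\<lambda>i. - (\<phi> i * sin (t * \<phi> i))) + U ** diag (\<lambda>i. \<phi> i * cos (t * \<phi> i))" for t
  have gram: "transpose (A ** diag a + U ** diag b) ** (A ** diag c + U ** diag d)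
      = diag (\<lambda>i. a i * c i + b i * \<nu> i * d i)" for a b c d
  proof -
    have "transpose (A ** diag a + U ** diag b) ** (A ** diag c + U ** diag d)
      = diag a ** (transpose A ** A) ** diag c + diag a ** (transpose A ** U) ** diag d
        + diag b ** (transpose U ** A) ** diag c + diag b ** (transpose U ** U) ** diag d"
      by (simp add: transpose_linear matrix_transpose_mul transpose_diag matrix_mult_bilinear matrix_mul_assoc)
    then show ?thesis by (simp add: A AU UA UU matrix_mult_bilinear diag_mult diag_add)
  qed
  have FF: "transpose (F t) ** F t = mat 1" for t
    unfolding F_def gram diag_const_1[symmetric]
    by (rule arg_cong[of _ _ diag]) (auto simp: \<nu>_def simp flip: power2_eq_square)
  have FG: "transpose (F t) ** G t = 0" for t
  proof -
    have "transpose (F t) ** G t = diag (\<lambda>i. 0)"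
      unfolding F_def G_def gram by (rule arg_cong[of _ _ diag]) (auto simp: \<nu>_def)
    then show ?thesis by (simp add: diag_def vec_eq_iff)
  qed
  have normG: "norm (G t) = sqrt (\<Sum>i\<in>UNIV. (\<phi> i)\<^sup>2)" for t
  proof -
    have "transpose (G t) ** G t = diag (\<lambda>i. (\<phi> i)\<^sup>2)"
      unfolding G_def gram
    proof (rule arg_cong[of _ _ diag], rule ext)
      fix i
      have "- (\<phi> i * sin (t * \<phi> i)) * - (\<phi> i * sin (t * \<phi> i)) + \<phi> i * cos (t * \<phi> i) * \<nu> i * (\<phi> i * cos (t * \<phi> i))
        = (\<phi> i)\<^sup>2 * ((sin (t * \<phi> i))\<^sup>2 + (cos (t * \<phi> i))\<^sup>2)"
        by (cases "\<phi> i = 0") (simp_all add: \<nu>_def power2_eq_square algebra_simps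
            del: sin_cos_squared_add sin_cos_squared_add2 sin_cos_squared_add3)
      then show "- (\<phi> i * sin (t * \<phi> i)) * - (\<phi> i * sin (t * \<phi> i)) + \<phi> i * cos (t * \<phi> i) * \<nu> i * (\<phi> i * cos (t * \<phi> i))
        = (\<phi> i)\<^sup>2" by simp
    qed
    then show ?thesis by (simp add: norm_eq_sqrt_inner inner_matrix_eq_trace trace_diag)
  qed
  have Fder: "(F has_vector_derivative G t) (at t)" for t
    unfolding F_def[abs_def] G_def
    by (intro has_vector_derivative_add diag_has_vector_derivative
        bounded_linear.has_vector_derivative[OF bounded_bilinear.bounded_linear_right[OF bounded_bilinear_matrix_mult]])
      (auto intro!: derivative_eq_intros)
  have Gcont: "continuous_on S G" for S
    unfolding G_def[abs_def]
    by (intro continuous_on_add continuous_on_diag continuous_intros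
        bounded_linear.continuous_on[OF bounded_bilinear.bounded_linear_right[OF bounded_bilinear_matrix_mult]])
  have Fcont: "continuous_on S F" for S
    using Fder by (intro continuous_at_imp_continuous_on) (auto intro: has_vector_derivative_continuous)
  define \<gamma> where "\<gamma> t = frame_involution (F t)" for t
  define D where "D t = - (2 *\<^sub>R (F t ** transpose (G t) + G t ** transpose (F t)))" for t
  have \<gamma>der: "(\<gamma> has_vector_derivative D t) (at t)" for t
  proof -
    have "((\<lambda>t. F t ** transpose (F t)) has_vector_derivative
        F t ** transpose (G t) + G t ** transpose (F t)) (at t)"
      by (rule bounded_bilinear.has_vector_derivative[OF bounded_bilinear_matrix_mult Fder
            bounded_linear.has_vector_derivative[OF bounded_linear_transpose Fder]])
    from bounded_linear.has_vector_derivative[OF bounded_linear_scaleR_right[of 2] this]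
    have "((\<lambda>t. 2 *\<^sub>R (F t ** transpose (F t))) has_vector_derivative
        2 *\<^sub>R (F t ** transpose (G t) + G t ** transpose (F t))) (at t)" .
    from has_vector_derivative_diff[OF has_vector_derivative_const[of "mat 1"] this]
    show ?thesis by (simp add: \<gamma>_def[abs_def] D_def frame_involution_def)
  qed
  have Dcont: "continuous_on {0..1} D"
    unfolding D_def[abs_def]
    by (intro continuous_intros bounded_bilinear.continuous_on[OF bounded_bilinear_matrix_mult]
        bounded_linear.continuous_on[OF bounded_linear_transpose] Fcont Gcont)
  have "F 0 = A"
    by (simp add: F_def diag_const_1) (simp add: diag_def matrix_matrix_mult_def vec_eq_iff)
  moreover have "F 1 = B"
    by (simp add: F_def flip: ZU) (simp add: Z_def)
  ultimately have path: "SO_path \<gamma> (frame_involution A) (frame_involution B)"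
    using \<gamma>der Dcont frame_involution_SO[OF even FF]
    by (auto simp: SO_path_def C1_differentiable_on_def \<gamma>_def)
  have "SO_length \<gamma> = 2 * sqrt (\<Sum>i\<in>UNIV. (\<phi> i)\<^sup>2)"
  proof (rule SO_pathE[OF path])
    fix D' assume D': "\<And>t. t \<in> {0..1} \<Longrightarrow> (\<gamma> has_vector_derivative D' t) (at t)"
      and len: "SO_length \<gamma> = integral {0..1} (\<lambda>t. norm (D' t)) / sqrt 2"
    have "norm (D' t) = 2 * sqrt 2 * sqrt (\<Sum>i\<in>UNIV. (\<phi> i)\<^sup>2)" if "t \<in> {0..1}" for t
    proof -
      have "D' t = D t" using vector_derivative_unique_at[OF D'[OF that] \<gamma>der] .
      then show ?thesis
        using norm_frame_involution_velocity[OF FF FG, of t] by (simp add: D_def normG)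
    qed
    then have "integral {0..1} (\<lambda>t. norm (D' t)) = integral {0..1} (\<lambda>t :: real. 2 * sqrt 2 * sqrt (\<Sum>i\<in>UNIV. (\<phi> i)\<^sup>2))"
      by (rule integral_cong)
    then show ?thesis by (simp add: len)
  qed
  then show ?thesis using path by blast
qed

theorem proposition4p9:
  assumes "2 \<le> CARD('p::finite)"
    and "even CARD('m::finite)" and "0 < CARD('m)" and "CARD('m) \<le> CARD('p)"
  shows "bij_betw Phi (Gr CARD('m) :: (real^'p) set set) (Inv_SO CARD('m)) \<and>
    (\<forall>W \<in> (Gr CARD('m) :: (real^'p) set set). \<forall>V \<in> Gr CARD('m).
      d_SO (Phi W) (Phi V) = 2 * d_Gr TYPE('m) W V)"
proof (intro conjI ballI)
  show "bij_betw Phi (Gr CARD('m) :: (real^'p) set set) (Inv_SO CARD('m))"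
    by (rule bij_betw_Phi[OF assms(2)])
next
  fix W V :: "(real^'p) set"
  assume W: "W \<in> Gr CARD('m)" and V: "V \<in> Gr CARD('m)"
  obtain A B :: "real^'m^'p" and \<phi> where
    orth: "transpose A ** A = mat 1" "transpose B ** B = mat 1"
    and Phi: "Phi W = frame_involution A" "Phi V = frame_involution B"
    and angles: "transpose A ** B = diag (\<lambda>i. cos (\<phi> i))"
      "\<And>i. 0 \<le> \<phi> i" "\<And>i. \<phi> i \<le> pi / 2"
    and dist: "d_Gr TYPE('m) W V = sqrt (\<Sum>i\<in>UNIV. (\<phi> i)\<^sup>2)"
    by (rule ex_principal_frames[OF W V]) (rule that, assumption+)
  show "d_SO (Phi W) (Phi V) = 2 * d_Gr TYPE('m) W V"
    unfolding d_SO_def Phi dist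
  proof (rule cInf_eq_minimum)
    show "2 * sqrt (\<Sum>i\<in>UNIV. (\<phi> i)\<^sup>2)
      \<in> {SO_length \<gamma> |\<gamma>. SO_path \<gamma> (frame_involution A) (frame_involution B)}"
      using ex_SO_path_principal_angles[OF assms(2) orth angles] by (auto intro: sym)
    fix l assume "l \<in> {SO_length \<gamma> |\<gamma>. SO_path \<gamma> (frame_involution A) (frame_involution B)}"
    then show "2 * sqrt (\<Sum>i\<in>UNIV. (\<phi> i)\<^sup>2) \<le> l"
      using SO_length_ge_principal_angles[OF orth angles] by auto
  qed
qed

end
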